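(* Let $X=\mathbb{R}^d$ with Borel $\sigma$-algebra $\mathcal{A}$, let $\mathbb{V},\mathbb{W}$ be Banach spaces over $\mathbb{F}\in\{\mathbb{R},\mathbb{C}\}$, and let $k\ge0$ be an integer. Let $\mu\in C^k[L(\mathbb{V},\mathbb{W}),\mathscr{T}_{sv}]$ have continuous semivariation $\widehat{\mu}$, and let $f\in C_B^k[X,\mathbb{V}]$ and $\varphi\in C_B^k[X,L(\mathbb{V})]$. Then for every multivector $h\in M_0^kX$ (of order at most $k$) $$\int_X\mu(dx)\,\varphi(x)\,\partial_hf(x)=(-1)^{|h|}\sum_{\alpha+\beta=h}C(\alpha,\beta)\int_X\partial_\alpha\mu(dx)\,\partial_\beta\varphi(x)\,f(x),$$ where the sum is over all ordered pairs $(\alpha,\beta)$ of multivectors with $\alpha+\beta=h$.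
   Context: $L(\mathbb{V},\mathbb{W})$: bounded linear operators with operator norm; $L(\mathbb{V})=L(\mathbb{V},\mathbb{V})$. $\mathrm{CA}[\mathcal{A},Y]$: $Y$-valued measures on $\mathcal{A}$ countably additive in norm. Semivariation of $\mu\in\mathrm{CA}[\mathcal{A},L(\mathbb{V},\mathbb{W})]$: $\widehat{\mu}(A)=\sup\{\|\sum_{i=1}^m\mu(A_i)v_i\|: A_i\in\mathcal{A}\text{ disjoint, finitely many, contained in }A,\ \|v_i\|\le1\}$. It is continuous if $A_n\searrow\varnothing$ in $\mathcal{A}$ implies $\widehat{\mu}(A_n)\to0$ (this implies $\widehat{\mu}(X)<\infty$). $\|\mu\|_{sv}=\widehat{\mu}(X)$; $\mathscr{T}_{sv}$ is the topology it induces. Smoothness: $\mu_x(A)=\mu(A+x)$. $\mu\in C^k[L(\mathbb{V},\mathbb{W}),\mathscr{T}_{sv}]$ means that $X\ni x\mapsto\mu_x\in\mathrm{CA}[\mathcal{A},L(\mathbb{V},\mathbb{W})]$ is $k$ times continuously (Fréchet) differentiable with respect to $\|\cdot\|_{sv}$ (continuous if $k=0$). The Fomin derivative along $h\in X$ is $\partial_h\mu=\lim_{t\to0}(\mu_{th}-\mu)/t$; higher mixed derivatives are obtained by iteration. Multivectors: functions $h:X\to\{0,1,2,\dots\}$ with $|h|:=\sum_{x\in X}h(x)<\infty$; $M_0^kX$ is the set of those with $|h|\le k$. $\partial_h$ is the mixed derivative in which each $x\in X$ is used $h(x)$ times (order irrelevant for $C^k$ objects with $|h|\le k$; identity for $h=0$).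 $C(\alpha,\beta)=\prod_{x\in X}\frac{(\alpha(x)+\beta(x))!}{\alpha(x)!\,\beta(x)!}$. $C_B^k[X,E]$: $k$ times continuously differentiable functions $X\to E$ bounded together with all derivatives of order up to $k$. Dobrakov integral with respect to $\gamma\in\mathrm{CA}[\mathcal{A},L(\mathbb{V},\mathbb{W})]$ of finite semivariation: for simple $s=\sum_i\chi_{A_i}v_i$ ($A_i\in\mathcal A$ disjoint, finitely many, $v_i\in\mathbb{V}$), $\int_As\,d\gamma=\sum_i\gamma(A\cap A_i)v_i\in\mathbb{W}$. $f:X\to\mathbb{V}$ is integrable if there are simple $s_n\to f$ almost everywhere (outside a set of zero $\widehat{\gamma}$-semivariation) such that $\lim_n\int_As_n\,d\gamma$ exists for every $A\in\mathcal{A}$; then $\int_Af\,d\gamma=\int_A\gamma(dx)f(x)$ is this limit (independent of the sequence). Bounded continuous functions are integrable with respect to measures of continuous semivariation, and each $\partial_\alpha\mu$ with $|\alpha|\le k$ has continuous semivariation. In $\int_X\gamma(dx)\,\psi(x)f(x)$ with $\psi:X\to L(\mathbb{V})$, the integrand is $x\mapsto\psi(x)[f(x)]\in\mathbb{V}$. *)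

theory Defs
  imports "HOL-Analysis.Analysis" "HOL-Library.Multiset"
begin

section \<open>Scalars\<close>

text \<open>
  The scalar field is a set \<open>F\<close> of complex numbers, meant to be either \<open>\<real>\<close> or \<open>UNIV\<close>.
  A Banach space over \<open>F\<close> is a type of class \<^class>\<open>banach\<close> with a scalar multiplication by
  elements of \<open>F\<close> that extends the real one; its values outside \<open>F\<close> are irrelevant.
\<close>

definition normed_scaling :: "complex set \<Rightarrow> (complex \<Rightarrow> 'v \<Rightarrow> 'v::real_normed_vector) \<Rightarrow> bool" where
  "normed_scaling F s \<longleftrightarrow>
     (\<forall>c\<in>F. \<forall>u v. s c (u + v) = s c u + s c v) \<and>
     (\<forall>c\<in>F. \<forall>e\<in>F. \<forall>v. s (c + e) v = s c v + s e v) \<and>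
     (\<forall>c\<in>F. \<forall>e\<in>F. \<forall>v. s (c * e) v = s c (s e v)) \<and>
     (\<forall>r v. s (of_real r) v = r *\<^sub>R v) \<and>
     (\<forall>c\<in>F. \<forall>v. norm (s c v) = cmod c * norm v)"

definition linear_ops ::
  "complex set \<Rightarrow> (complex \<Rightarrow> 'v \<Rightarrow> 'v) \<Rightarrow> (complex \<Rightarrow> 'w \<Rightarrow> 'w) \<Rightarrow>
   ('v::real_normed_vector \<Rightarrow>\<^sub>L 'w::real_normed_vector) set" where
  "linear_ops F sV sW = {T. \<forall>c\<in>F. \<forall>v. blinfun_apply T (sV c v) = sW c (blinfun_apply T v)}"


section \<open>Operator-valued measures and semivariation\<close>

definition additive_in_norm ::
  "('a::topological_space set \<Rightarrow> 'y::real_normed_vector) \<Rightarrow> bool" where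
  "additive_in_norm \<mu> \<longleftrightarrow>
     (\<forall>A::nat \<Rightarrow> 'a set. range A \<subseteq> sets borel \<longrightarrow> disjoint_family A \<longrightarrow>
        (\<lambda>n. \<mu> (A n)) sums \<mu> (\<Union>n. A n))"

definition semivariation ::
  "('a::topological_space set \<Rightarrow> 'v::real_normed_vector \<Rightarrow>\<^sub>L 'w::real_normed_vector) \<Rightarrow>
   'a set \<Rightarrow> ennreal" where
  "semivariation \<mu> A =
     (SUP (m, B, v) \<in> {(m::nat, B, v).
           disjoint_family_on B {..<m} \<and>
           (\<forall>i<m. B i \<in> sets borel \<and> B i \<subseteq> A \<and> norm (v i) \<le> 1)}.
        ennreal (norm (\<Sum>i<m. blinfun_apply (\<mu> (B i)) (v i))))"

definition continuous_semivariation ::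
  "('a::topological_space set \<Rightarrow> 'v::real_normed_vector \<Rightarrow>\<^sub>L 'w::real_normed_vector) \<Rightarrow> bool" where
  "continuous_semivariation \<mu> \<longleftrightarrow>
     (\<forall>A::nat \<Rightarrow> 'a set. range A \<subseteq> sets borel \<longrightarrow> decseq A \<longrightarrow> (\<Inter>n. A n) = {} \<longrightarrow>
        (\<lambda>n. semivariation \<mu> (A n)) \<longlonglongrightarrow> 0)"

lemma semivariation_upper:
  fixes m :: nat
  assumes "disjoint_family_on B {..<m}"
    and "\<And>i. i < m \<Longrightarrow> B i \<in> sets borel \<and> B i \<subseteq> A \<and> norm (v i) \<le> 1"
  shows "ennreal (norm (\<Sum>i<m. blinfun_apply (\<mu> (B i)) (v i))) \<le> semivariation \<mu> A"
  unfolding semivariation_def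
  by (rule SUP_upper2[of "(m, B, v)"]) (use assms in auto)

lemma semivariation_least:
  assumes "\<And>(m::nat) B v. disjoint_family_on B {..<m} \<Longrightarrow>
      (\<And>i. i < m \<Longrightarrow> B i \<in> sets borel \<and> B i \<subseteq> A \<and> norm (v i) \<le> 1) \<Longrightarrow>
      ennreal (norm (\<Sum>i<m. blinfun_apply (\<mu> (B i)) (v i))) \<le> c"
  shows "semivariation \<mu> A \<le> c"
  unfolding semivariation_def by (rule SUP_least) (use assms in auto)

lemma semivariation_add:
  "semivariation (\<lambda>A. \<mu> A + \<nu> A) A \<le> semivariation \<mu> A + semivariation \<nu> A"
proof (rule semivariation_least)
  fix m :: nat and B :: "nat \<Rightarrow> 'a set" and v :: "nat \<Rightarrow> 'b"
  assume *: "disjoint_family_on B {..<m}"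
    "\<And>i. i < m \<Longrightarrow> B i \<in> sets borel \<and> B i \<subseteq> A \<and> norm (v i) \<le> 1"
  have "ennreal (norm (\<Sum>i<m. blinfun_apply (\<mu> (B i) + \<nu> (B i)) (v i)))
      = ennreal (norm ((\<Sum>i<m. blinfun_apply (\<mu> (B i)) (v i)) + (\<Sum>i<m. blinfun_apply (\<nu> (B i)) (v i))))"
    by (simp add: blinfun.add_left sum.distrib)
  also have "\<dots> \<le> ennreal (norm (\<Sum>i<m. blinfun_apply (\<mu> (B i)) (v i)) + norm (\<Sum>i<m. blinfun_apply (\<nu> (B i)) (v i)))"
    by (intro ennreal_leI norm_triangle_ineq)
  also have "\<dots> = ennreal (norm (\<Sum>i<m. blinfun_apply (\<mu> (B i)) (v i))) + ennreal (norm (\<Sum>i<m. blinfun_apply (\<nu> (B i)) (v i)))"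
    by simp
  also have "\<dots> \<le> semivariation \<mu> A + semivariation \<nu> A"
    by (intro add_mono semivariation_upper *)
  finally show "ennreal (norm (\<Sum>i<m. blinfun_apply (\<mu> (B i) + \<nu> (B i)) (v i)))
      \<le> semivariation \<mu> A + semivariation \<nu> A" .
qed

lemma semivariation_scaleR_le:
  "semivariation (\<lambda>A. c *\<^sub>R \<mu> A) A \<le> ennreal \<bar>c\<bar> * semivariation \<mu> A"
proof (rule semivariation_least)
  fix m :: nat and B :: "nat \<Rightarrow> 'a set" and v :: "nat \<Rightarrow> 'b"
  assume *: "disjoint_family_on B {..<m}"
    "\<And>i. i < m \<Longrightarrow> B i \<in> sets borel \<and> B i \<subseteq> A \<and> norm (v i) \<le> 1"
  have "ennreal (norm (\<Sum>i<m. blinfun_apply (c *\<^sub>R \<mu> (B i)) (v i)))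
      = ennreal (\<bar>c\<bar> * norm (\<Sum>i<m. blinfun_apply (\<mu> (B i)) (v i)))"
    by (simp add: blinfun.scaleR_left scaleR_sum_right[symmetric])
  also have "\<dots> = ennreal \<bar>c\<bar> * ennreal (norm (\<Sum>i<m. blinfun_apply (\<mu> (B i)) (v i)))"
    by (simp add: ennreal_mult)
  also have "\<dots> \<le> ennreal \<bar>c\<bar> * semivariation \<mu> A"
    by (intro mult_left_mono semivariation_upper *) auto
  finally show "ennreal (norm (\<Sum>i<m. blinfun_apply (c *\<^sub>R \<mu> (B i)) (v i)))
      \<le> ennreal \<bar>c\<bar> * semivariation \<mu> A" .
qed

lemma semivariation_zero [simp]: "semivariation (\<lambda>_. 0) A = 0"
  using semivariation_scaleR_le[of 0 "\<lambda>_. 0" A] by simp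

lemma norm_le_semivariation:
  fixes \<mu> :: "'a::topological_space set \<Rightarrow> 'v::real_normed_vector \<Rightarrow>\<^sub>L 'w::real_normed_vector"
  assumes "B \<in> sets borel" and "B \<subseteq> A" and fin: "semivariation \<mu> A < \<infinity>"
  shows "norm (\<mu> B) \<le> enn2real (semivariation \<mu> A)"
proof (rule norm_blinfun_bound)
  fix x :: 'v
  have unit: "norm (blinfun_apply (\<mu> B) v) \<le> enn2real (semivariation \<mu> A)" if "norm v \<le> 1" for v
  proof -
    have "ennreal (norm (\<Sum>i<(1::nat). blinfun_apply (\<mu> B) v)) \<le> semivariation \<mu> A"
      by (rule semivariation_upper[where B = "\<lambda>_. B" and v = "\<lambda>_. v" and m = 1])
        (use assms that in \<open>auto simp: disjoint_family_on_def\<close>)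
    then have "enn2real (ennreal (norm (blinfun_apply (\<mu> B) v))) \<le> enn2real (semivariation \<mu> A)"
      using fin by (intro enn2real_mono) auto
    then show ?thesis by simp
  qed
  show "norm (blinfun_apply (\<mu> B) x) \<le> enn2real (semivariation \<mu> A) * norm x"
  proof (cases "x = 0")
    case False
    have "norm (blinfun_apply (\<mu> B) x) = norm x * norm (blinfun_apply (\<mu> B) (x /\<^sub>R norm x))"
      using False by (simp add: blinfun.scaleR_right)
    also have "\<dots> \<le> norm x * enn2real (semivariation \<mu> A)"
      using False by (intro mult_left_mono unit) auto
    finally show ?thesis by (simp add: mult.commute)
  qed simp
qed simp

text \<open>
  The measures of finite semivariation, normed by \<open>\<mu> \<mapsto> semivariation \<mu> UNIV\<close>. Measures of
  continuous semivariation belong to this space, and so do all limits (hence derivatives)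
  of its elements in the (possibly infinite-valued) semivariation norm on all countably
  additive measures. Set functions are totalised by \<open>0\<close> on non-measurable sets, so
  that equality of elements is equality on measurable sets.
\<close>

typedef (overloaded) ('a, 'v, 'w) sv_measure =
  "{\<mu> :: 'a::euclidean_space set \<Rightarrow> 'v::real_normed_vector \<Rightarrow>\<^sub>L 'w::real_normed_vector.
     additive_in_norm \<mu> \<and> semivariation \<mu> UNIV < \<infinity> \<and> (\<forall>A. A \<notin> sets borel \<longrightarrow> \<mu> A = 0)}"
  morphisms measure_of_sv Abs_sv_measure
  by (rule exI[of _ "\<lambda>_. 0"]) (simp add: additive_in_norm_def)

setup_lifting type_definition_sv_measure

instantiation sv_measure ::
  (euclidean_space, real_normed_vector, real_normed_vector) real_normed_vector
begin

lift_definition zero_sv_measure :: "('a, 'b, 'c) sv_measure" is "\<lambda>_. 0"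
  by (simp add: additive_in_norm_def)

lift_definition plus_sv_measure ::
  "('a, 'b, 'c) sv_measure \<Rightarrow> ('a, 'b, 'c) sv_measure \<Rightarrow> ('a, 'b, 'c) sv_measure"
  is "\<lambda>\<mu> \<nu> A. \<mu> A + \<nu> A"
proof -
  fix \<mu> \<nu> :: "'a set \<Rightarrow> 'b \<Rightarrow>\<^sub>L 'c"
  assume *: "additive_in_norm \<mu> \<and> semivariation \<mu> UNIV < \<infinity> \<and> (\<forall>A. A \<notin> sets borel \<longrightarrow> \<mu> A = 0)"
    "additive_in_norm \<nu> \<and> semivariation \<nu> UNIV < \<infinity> \<and> (\<forall>A. A \<notin> sets borel \<longrightarrow> \<nu> A = 0)"
  have "additive_in_norm (\<lambda>A. \<mu> A + \<nu> A)"
    using * unfolding additive_in_norm_def by (auto intro!: sums_add)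
  moreover have "semivariation (\<lambda>A. \<mu> A + \<nu> A) UNIV < \<infinity>"
    by (rule le_less_trans[OF semivariation_add]) (use * in \<open>simp add: ennreal_add_less_top\<close>)
  ultimately show "additive_in_norm (\<lambda>A. \<mu> A + \<nu> A) \<and>
      semivariation (\<lambda>A. \<mu> A + \<nu> A) UNIV < \<infinity> \<and> (\<forall>A. A \<notin> sets borel \<longrightarrow> \<mu> A + \<nu> A = 0)"
    using * by simp
qed

lift_definition scaleR_sv_measure ::
  "real \<Rightarrow> ('a, 'b, 'c) sv_measure \<Rightarrow> ('a, 'b, 'c) sv_measure"
  is "\<lambda>c \<mu> A. c *\<^sub>R \<mu> A"
proof -
  fix c and \<mu> :: "'a set \<Rightarrow> 'b \<Rightarrow>\<^sub>L 'c"
  assume *: "additive_in_norm \<mu> \<and> semivariation \<mu> UNIV < \<infinity> \<and> (\<forall>A. A \<notin> sets borel \<longrightarrow> \<mu> A = 0)"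
  have "additive_in_norm (\<lambda>A. c *\<^sub>R \<mu> A)"
    using * unfolding additive_in_norm_def by (auto intro!: sums_scaleR_right)
  moreover have "semivariation (\<lambda>A. c *\<^sub>R \<mu> A) UNIV < \<infinity>"
    by (rule le_less_trans[OF semivariation_scaleR_le])
      (use * in \<open>simp add: ennreal_mult_less_top\<close>)
  ultimately show "additive_in_norm (\<lambda>A. c *\<^sub>R \<mu> A) \<and>
      semivariation (\<lambda>A. c *\<^sub>R \<mu> A) UNIV < \<infinity> \<and> (\<forall>A. A \<notin> sets borel \<longrightarrow> c *\<^sub>R \<mu> A = 0)"
    using * by simp
qed

definition uminus_sv_measure :: "('a, 'b, 'c) sv_measure \<Rightarrow> ('a, 'b, 'c) sv_measure" where
  "uminus_sv_measure \<mu> = (-1) *\<^sub>R \<mu>"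

definition minus_sv_measure ::
  "('a, 'b, 'c) sv_measure \<Rightarrow> ('a, 'b, 'c) sv_measure \<Rightarrow> ('a, 'b, 'c) sv_measure" where
  "minus_sv_measure \<mu> \<nu> = \<mu> + (-1) *\<^sub>R \<nu>"

definition norm_sv_measure :: "('a, 'b, 'c) sv_measure \<Rightarrow> real" where
  "norm_sv_measure \<mu> = enn2real (semivariation (measure_of_sv \<mu>) UNIV)"

definition dist_sv_measure :: "('a, 'b, 'c) sv_measure \<Rightarrow> ('a, 'b, 'c) sv_measure \<Rightarrow> real" where
  "dist_sv_measure \<mu> \<nu> = norm (\<mu> - \<nu>)"

definition sgn_sv_measure :: "('a, 'b, 'c) sv_measure \<Rightarrow> ('a, 'b, 'c) sv_measure" where
  "sgn_sv_measure \<mu> = inverse (norm \<mu>) *\<^sub>R \<mu>"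

definition uniformity_sv_measure ::
  "(('a, 'b, 'c) sv_measure \<times> ('a, 'b, 'c) sv_measure) filter" where
  "uniformity_sv_measure = (INF e\<in>{0<..}. principal {(x, y). dist x y < e})"

definition open_sv_measure :: "('a, 'b, 'c) sv_measure set \<Rightarrow> bool" where
  "open_sv_measure U = (\<forall>x\<in>U. eventually (\<lambda>(x', y). x' = x \<longrightarrow> y \<in> U) uniformity)"

instance
proof
  fix \<mu> \<nu> \<rho> :: "('a, 'b, 'c) sv_measure" and a b :: real
  have fin: "semivariation (measure_of_sv \<mu>) UNIV < \<infinity>" for \<mu> :: "('a, 'b, 'c) sv_measure"
    using measure_of_sv[of \<mu>] by simp
  show "\<mu> + \<nu> + \<rho> = \<mu> + (\<nu> + \<rho>)" by transfer (simp add: add.assoc)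
  show "\<mu> + \<nu> = \<nu> + \<mu>" by transfer (simp add: add.commute)
  show "0 + \<mu> = \<mu>" by transfer simp
  show "- \<mu> + \<mu> = 0" unfolding uminus_sv_measure_def by transfer simp
  show "\<mu> - \<nu> = \<mu> + - \<nu>" by (simp add: uminus_sv_measure_def minus_sv_measure_def)
  show "a *\<^sub>R (\<mu> + \<nu>) = a *\<^sub>R \<mu> + a *\<^sub>R \<nu>" by transfer (simp add: scaleR_add_right)
  show "(a + b) *\<^sub>R \<mu> = a *\<^sub>R \<mu> + b *\<^sub>R \<mu>" by transfer (simp add: scaleR_add_left)
  show "a *\<^sub>R b *\<^sub>R \<mu> = (a * b) *\<^sub>R \<mu>" by transfer simp
  show "1 *\<^sub>R \<mu> = \<mu>" by transfer simp
  show "dist \<mu> \<nu> = norm (\<mu> - \<nu>)" by (rule dist_sv_measure_def)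
  show "sgn \<mu> = inverse (norm \<mu>) *\<^sub>R \<mu>" by (rule sgn_sv_measure_def)
  show "uniformity = (INF e\<in>{0<..}. principal {(x, y :: ('a, 'b, 'c) sv_measure). dist x y < e})"
    by (rule uniformity_sv_measure_def)
  show "open U \<longleftrightarrow> (\<forall>x\<in>U. eventually (\<lambda>(x', y). x' = x \<longrightarrow> y \<in> U) uniformity)"
    for U :: "('a, 'b, 'c) sv_measure set"
    by (rule open_sv_measure_def)
  show "norm \<mu> = 0 \<longleftrightarrow> \<mu> = 0"
  proof
    assume z: "norm \<mu> = 0"
    have "measure_of_sv \<mu> A = 0" for A
    proof (cases "A \<in> sets borel")
      case True
      then have "norm (measure_of_sv \<mu> A) \<le> norm \<mu>"
        unfolding norm_sv_measure_def by (intro norm_le_semivariation fin) auto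
      with z show ?thesis by simp
    qed (use measure_of_sv[of \<mu>] in auto)
    then have "measure_of_sv \<mu> = measure_of_sv 0"
      unfolding zero_sv_measure.rep_eq by (rule ext)
    then show "\<mu> = 0" by (simp only: measure_of_sv_inject)
  qed (simp add: norm_sv_measure_def zero_sv_measure.rep_eq)
  have "semivariation (measure_of_sv (\<mu> + \<nu>)) UNIV
      \<le> semivariation (measure_of_sv \<mu>) UNIV + semivariation (measure_of_sv \<nu>) UNIV"
    unfolding plus_sv_measure.rep_eq by (rule semivariation_add)
  then have "norm (\<mu> + \<nu>) \<le> enn2real (semivariation (measure_of_sv \<mu>) UNIV + semivariation (measure_of_sv \<nu>) UNIV)"
    unfolding norm_sv_measure_def using fin[of \<mu>] fin[of \<nu>] by (intro enn2real_mono) auto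
  then show "norm (\<mu> + \<nu>) \<le> norm \<mu> + norm \<nu>"
    unfolding norm_sv_measure_def using fin[of \<mu>] fin[of \<nu>] by (simp add: enn2real_plus)
  have le: "norm (c *\<^sub>R \<nu>) \<le> \<bar>c\<bar> * norm \<nu>" for c and \<nu> :: "('a, 'b, 'c) sv_measure"
  proof -
    have "norm (c *\<^sub>R \<nu>) \<le> enn2real (ennreal \<bar>c\<bar> * semivariation (measure_of_sv \<nu>) UNIV)"
      unfolding norm_sv_measure_def scaleR_sv_measure.rep_eq using fin[of \<nu>]
      by (intro enn2real_mono semivariation_scaleR_le) (simp add: ennreal_mult_less_top)
    then show ?thesis by (simp add: norm_sv_measure_def enn2real_mult)
  qed
  show "norm (a *\<^sub>R \<mu>) = \<bar>a\<bar> * norm \<mu>"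
  proof (rule antisym[OF le])
    show "\<bar>a\<bar> * norm \<mu> \<le> norm (a *\<^sub>R \<mu>)"
    proof (cases "a = 0")
      case False
      have "measure_of_sv (inverse a *\<^sub>R a *\<^sub>R \<mu>) = measure_of_sv \<mu>"
        unfolding scaleR_sv_measure.rep_eq using False by simp
      then have "inverse a *\<^sub>R a *\<^sub>R \<mu> = \<mu>" by (simp only: measure_of_sv_inject)
      then have "norm \<mu> \<le> \<bar>inverse a\<bar> * norm (a *\<^sub>R \<mu>)"
        using le[of "inverse a" "a *\<^sub>R \<mu>"] by (simp only:)
      then have "\<bar>a\<bar> * norm \<mu> \<le> \<bar>a\<bar> * (\<bar>inverse a\<bar> * norm (a *\<^sub>R \<mu>))"
        by (rule mult_left_mono) simp
      also have "\<dots> = norm (a *\<^sub>R \<mu>)"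
        using False by (simp only: mult.assoc[symmetric] abs_mult[symmetric]) simp
      finally show ?thesis .
    qed (simp add: norm_sv_measure_def)
  qed
qed

end

text \<open>The translate \<open>\<mu>\<^sub>x(A) = \<mu>(A + x)\<close>.\<close>

lemma borel_translation_iff:
  fixes x :: "'a::euclidean_space"
  shows "(\<lambda>a. a + x) ` A \<in> sets borel \<longleftrightarrow> A \<in> sets borel"
proof -
  have tr: "(\<lambda>a. a + y) ` B \<in> sets borel" if "B \<in> sets borel" for y :: 'a and B
  proof -
    have "(\<lambda>a. a - y) \<in> borel_measurable borel"
      by measurable
    from measurable_sets[OF this that] have "(\<lambda>a. a - y) -` B \<in> sets borel"
      by simp
    moreover have "(\<lambda>a. a - y) -` B = (\<lambda>a. a + y) ` B"
    proof (intro set_eqI iffI)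
      fix a assume "a \<in> (\<lambda>a. a - y) -` B"
      then show "a \<in> (\<lambda>a. a + y) ` B" by (intro image_eqI[of _ _ "a - y"]) auto
    qed auto
    ultimately show ?thesis by simp
  qed
  have "(\<lambda>a. a + (- x)) ` (\<lambda>a. a + x) ` A = A" by (simp add: image_image)
  then show ?thesis using tr[of A x] tr[of "(\<lambda>a. a + x) ` A" "- x"] by metis
qed

lift_definition translate ::
  "'a::euclidean_space \<Rightarrow> ('a, 'v::real_normed_vector, 'w::real_normed_vector) sv_measure \<Rightarrow>
   ('a, 'v, 'w) sv_measure"
  is "\<lambda>x \<mu> A. \<mu> ((\<lambda>a. a + x) ` A)"
proof -
  fix x :: 'a and \<mu> :: "'a set \<Rightarrow> 'v \<Rightarrow>\<^sub>L 'w"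
  assume *: "additive_in_norm \<mu> \<and> semivariation \<mu> UNIV < \<infinity> \<and> (\<forall>A. A \<notin> sets borel \<longrightarrow> \<mu> A = 0)"
  let ?t = "\<lambda>A. (\<lambda>a. a + x) ` A"
  have disj: "?t A \<inter> ?t B = ?t (A \<inter> B)" for A B by auto
  have "additive_in_norm (\<lambda>A. \<mu> (?t A))"
    unfolding additive_in_norm_def
  proof (intro allI impI)
    fix A :: "nat \<Rightarrow> 'a set"
    assume A: "range A \<subseteq> sets borel" "disjoint_family A"
    have "range (\<lambda>n. ?t (A n)) \<subseteq> sets borel"
      using A(1) borel_translation_iff by blast
    moreover have "disjoint_family (\<lambda>n. ?t (A n))"
      using A(2) unfolding disjoint_family_on_def disj by auto
    ultimately have "(\<lambda>n. \<mu> (?t (A n))) sums \<mu> (\<Union>n. ?t (A n))"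
      using * unfolding additive_in_norm_def by blast
    then show "(\<lambda>n. \<mu> (?t (A n))) sums \<mu> (?t (\<Union>n. A n))" by (simp add: image_UN)
  qed
  moreover have le: "semivariation (\<lambda>A. \<mu> (?t A)) UNIV \<le> semivariation \<mu> UNIV"
  proof (rule semivariation_least)
    fix m :: nat and B :: "nat \<Rightarrow> 'a set" and v :: "nat \<Rightarrow> 'v"
    assume B: "disjoint_family_on B {..<m}"
      "\<And>i. i < m \<Longrightarrow> B i \<in> sets borel \<and> B i \<subseteq> UNIV \<and> norm (v i) \<le> 1"
    show "ennreal (norm (\<Sum>i<m. blinfun_apply (\<mu> (?t (B i))) (v i))) \<le> semivariation \<mu> UNIV"
    proof (rule semivariation_upper)
      show "disjoint_family_on (\<lambda>i. ?t (B i)) {..<m}"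
        using B(1) unfolding disjoint_family_on_def disj by auto
    qed (use B borel_translation_iff in auto)
  qed
  moreover have "semivariation (\<lambda>A. \<mu> (?t A)) UNIV < \<infinity>"
    using le_less_trans[OF le] * by simp
  ultimately show "additive_in_norm (\<lambda>A. \<mu> (?t A)) \<and> semivariation (\<lambda>A. \<mu> (?t A)) UNIV < \<infinity> \<and>
      (\<forall>A. A \<notin> sets borel \<longrightarrow> \<mu> (?t A) = 0)"
    using * by (simp add: borel_translation_iff)
qed


section \<open>Smoothness\<close>

text \<open>
  \<open>D j x\<close> is the \<open>j\<close>-th Fr\'echet derivative of \<open>f\<close> at \<open>x\<close>, a bounded \<open>j\<close>-linear map; a \<open>j\<close>-tuple
  of vectors is a list of length \<open>j\<close>. Since the order \<open>j\<close> is not fixed, the spaces of bounded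
  \<open>j\<close>-linear maps are not types, and statements about their operator norm are written as
  estimates by \<open>prod_list (map norm hs)\<close>.
\<close>

definition bounded_multilinear ::
  "nat \<Rightarrow> ('a::real_normed_vector list \<Rightarrow> 'e::real_normed_vector) \<Rightarrow> bool" where
  "bounded_multilinear j T \<longleftrightarrow>
     (\<forall>us ws. length us + length ws + 1 = j \<longrightarrow> linear (\<lambda>v. T (us @ v # ws))) \<and>
     (\<exists>M. \<forall>hs. length hs = j \<longrightarrow> norm (T hs) \<le> M * prod_list (map norm hs))"

definition iterated_frechet ::
  "nat \<Rightarrow> ('a::real_normed_vector \<Rightarrow> 'e::real_normed_vector) \<Rightarrow>
   (nat \<Rightarrow> 'a \<Rightarrow> 'a list \<Rightarrow> 'e) \<Rightarrow> bool" where
  "iterated_frechet k f D \<longleftrightarrow>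
     (\<forall>x. D 0 x [] = f x) \<and>
     (\<forall>j\<le>k. \<forall>x. bounded_multilinear j (D j x)) \<and>
     (\<forall>j<k. \<forall>x. \<forall>\<epsilon>>0. \<forall>\<^sub>F y in nhds x. \<forall>hs. length hs = j \<longrightarrow>
        norm (D j y hs - D j x hs - D (Suc j) x ((y - x) # hs))
          \<le> \<epsilon> * norm (y - x) * prod_list (map norm hs)) \<and>
     (\<forall>x. \<forall>\<epsilon>>0. \<forall>\<^sub>F y in nhds x. \<forall>hs. length hs = k \<longrightarrow>
        norm (D k y hs - D k x hs) \<le> \<epsilon> * prod_list (map norm hs))"

definition C_k :: "nat \<Rightarrow> ('a::real_normed_vector \<Rightarrow> 'e::real_normed_vector) \<Rightarrow> bool" where
  "C_k k f \<longleftrightarrow> (\<exists>D. iterated_frechet k f D)"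

definition C_B_k :: "nat \<Rightarrow> ('a::real_normed_vector \<Rightarrow> 'e::real_normed_vector) \<Rightarrow> bool" where
  "C_B_k k f \<longleftrightarrow> (\<exists>D. iterated_frechet k f D \<and>
     (\<forall>j\<le>k. \<exists>M. \<forall>x hs. length hs = j \<longrightarrow> norm (D j x hs) \<le> M * prod_list (map norm hs)))"

definition C_k_sv ::
  "nat \<Rightarrow> ('a::euclidean_space, 'v::real_normed_vector, 'w::real_normed_vector) sv_measure \<Rightarrow> bool" where
  "C_k_sv k \<mu> \<longleftrightarrow> C_k k (\<lambda>x. translate x \<mu>)"

definition dir_deriv ::
  "'a::real_normed_vector \<Rightarrow> ('a \<Rightarrow> 'e::real_normed_vector) \<Rightarrow> 'a \<Rightarrow> 'e" where
  "dir_deriv h f x = vector_derivative (\<lambda>t. f (x + t *\<^sub>R h)) (at 0)"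

definition fomin_deriv ::
  "'a::euclidean_space \<Rightarrow> ('a, 'v::real_normed_vector, 'w::real_normed_vector) sv_measure \<Rightarrow>
   ('a, 'v, 'w) sv_measure" where
  "fomin_deriv h \<mu> = Lim (at 0) (\<lambda>t. (translate (t *\<^sub>R h) \<mu> - \<mu>) /\<^sub>R t)"

text \<open>
  A multivector \<open>h\<close> is a multiset of vectors, with \<open>h(x) = count h x\<close> and \<open>|h| = size h\<close>.
  The mixed derivative applies the derivatives along the elements of \<open>h\<close> in some fixed order;
  for the \<open>C\<^sup>k\<close> objects and \<open>|h| \<le> k\<close> the order does not matter.
\<close>

definition mixed :: "('a \<Rightarrow> 'e \<Rightarrow> 'e) \<Rightarrow> 'a multiset \<Rightarrow> 'e \<Rightarrow> 'e" where
  "mixed d h = foldr d (SOME xs. mset xs = h)"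

definition multi_coeff :: "'a multiset \<Rightarrow> 'a multiset \<Rightarrow> real" where
  "multi_coeff \<alpha> \<beta> = (\<Prod>x\<in>set_mset (\<alpha> + \<beta>).
     fact (count \<alpha> x + count \<beta> x) / (fact (count \<alpha> x) * fact (count \<beta> x)))"


section \<open>The Dobrakov integral\<close>

definition simple_integral_on ::
  "('a::topological_space set \<Rightarrow> 'v::real_normed_vector \<Rightarrow>\<^sub>L 'w::real_normed_vector) \<Rightarrow>
   'a set \<Rightarrow> ('a \<Rightarrow> 'v) \<Rightarrow> 'w" where
  "simple_integral_on \<gamma> A s = (\<Sum>v\<in>range s. blinfun_apply (\<gamma> (A \<inter> s -` {v})) v)"

definition dobrakov_approx ::
  "('a::topological_space set \<Rightarrow> 'v::real_normed_vector \<Rightarrow>\<^sub>L 'w::real_normed_vector) \<Rightarrow>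
   ('a \<Rightarrow> 'v) \<Rightarrow> (nat \<Rightarrow> 'a \<Rightarrow> 'v) \<Rightarrow> bool" where
  "dobrakov_approx \<gamma> f s \<longleftrightarrow>
     (\<forall>n. simple_function borel (s n)) \<and>
     (\<exists>N\<in>sets borel. semivariation \<gamma> N = 0 \<and> (\<forall>x. x \<notin> N \<longrightarrow> (\<lambda>n. s n x) \<longlonglongrightarrow> f x)) \<and>
     (\<forall>A\<in>sets borel. convergent (\<lambda>n. simple_integral_on \<gamma> A (s n)))"

definition has_dobrakov_integral ::
  "('a::topological_space set \<Rightarrow> 'v::real_normed_vector \<Rightarrow>\<^sub>L 'w::real_normed_vector) \<Rightarrow>
   'a set \<Rightarrow> ('a \<Rightarrow> 'v) \<Rightarrow> 'w \<Rightarrow> bool" where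
  "has_dobrakov_integral \<gamma> A f I \<longleftrightarrow>
     (\<exists>s. dobrakov_approx \<gamma> f s \<and> (\<lambda>n. simple_integral_on \<gamma> A (s n)) \<longlonglongrightarrow> I)"

definition dobrakov_integral ::
  "('a::euclidean_space, 'v::real_normed_vector, 'w::real_normed_vector) sv_measure \<Rightarrow>
   'a set \<Rightarrow> ('a \<Rightarrow> 'v) \<Rightarrow> 'w" where
  "dobrakov_integral \<gamma> A f = (THE I. has_dobrakov_integral (measure_of_sv \<gamma>) A f I)"

end

theory Submission
  imports Defs
begin

text \<open>
  The identity is integration by parts, applied once for each vector of \<open>h\<close>. For one vector \<open>v\<close>,
  let \<open>\<gamma>\<close> be a measure of continuous semivariation with Fomin derivative \<open>\<partial>\<^sub>v\<gamma>\<close>, and let \<open>g\<close> be bounded and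
  continuous with a bounded continuous derivative \<open>\<partial>\<^sub>vg\<close>. Translation invariance gives
  \<open>\<integral> d((\<gamma>\<^sub>t\<^sub>v - \<gamma>) / t) g = \<integral> \<gamma>(dx) (g(x - tv) - g(x)) / t\<close>. As \<open>t \<rightarrow> 0\<close> the left side tends to
  \<open>\<integral> d(\<partial>\<^sub>v\<gamma>) g\<close>, because the integral is bounded by the semivariation norm times the supremum norm,
  and the right side tends to \<open>- \<integral> \<gamma>(dx) \<partial>\<^sub>vg(x)\<close> by bounded convergence (\<open>dint_fomin_deriv\<close>). With
  \<open>g = \<psi> F\<close> and the product rule this moves one derivative off \<open>F\<close> (\<open>dint_by_parts\<close>). Induction on
  \<open>h\<close>, with Pascal's rule for the coefficients \<open>C(\<alpha>, \<beta>)\<close>, gives the Leibniz sum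
  (\<open>dint_by_parts_iterated\<close>).

  Three facts support this. First, for a measure of continuous semivariation the Dobrakov
  integral is unique: two approximating sequences differ by a null sequence of simple functions,
  and a gliding hump argument shows that the integrals of a null sequence tend to \<open>0\<close> as soon as they
  converge over every Borel set (\<open>dobrakov_null_sequence\<close>). Second, an Egoroff argument shows that
  any bounded sequence of simple functions that converges pointwise computes the integral of its limit
  (\<open>dint_limit\<close>); linearity, translation, norm bounds and bounded convergence for bounded continuous
  integrands all follow from it. Third, mixed derivatives do not depend on the order of
  differentiation (\<open>iter_deriv_mset_eq\<close>), by symmetry of continuous second derivatives. For Fomin
  derivatives this is read off from the map \<open>x \<mapsto> \<mu>\<^sub>x\<close>, whose iterated directional derivatives are
  the translates of the iterated Fomin derivatives of \<open>\<mu>\<close> (\<open>iter_deriv_translate\<close>).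
\<close>

section \<open>Semivariation as a real-valued set function\<close>

lemma semivariation_mono:
  assumes "A \<subseteq> B"
  shows "semivariation \<mu> A \<le> semivariation \<mu> B"
  using assms by (intro semivariation_least semivariation_upper) auto

text \<open>
  The semivariation as a real number. Nothing is lost: the elements of the space of measures
  have finite semivariation.
\<close>

definition svar ::
  "('a::euclidean_space, 'v::real_normed_vector, 'w::real_normed_vector) sv_measure \<Rightarrow>
   'a set \<Rightarrow> real" where
  "svar \<gamma> A = enn2real (semivariation (measure_of_sv \<gamma>) A)"

lemma semivariation_finite: "semivariation (measure_of_sv \<gamma>) A < \<infinity>"
  using le_less_trans[OF semivariation_mono[OF subset_UNIV]] measure_of_sv[of \<gamma>] by blast

lemma semivariation_eq_svar: "semivariation (measure_of_sv \<gamma>) A = ennreal (svar \<gamma> A)"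
  using semivariation_finite[of \<gamma> A] by (simp add: svar_def)

lemma svar_nonneg [simp]: "0 \<le> svar \<gamma> A"
  by (simp add: svar_def)

lemma svar_UNIV: "svar \<gamma> UNIV = norm \<gamma>"
  by (simp add: svar_def norm_sv_measure_def)

lemma svar_mono: "A \<subseteq> B \<Longrightarrow> svar \<gamma> A \<le> svar \<gamma> B"
  using semivariation_mono[of A B "measure_of_sv \<gamma>"] by (simp add: semivariation_eq_svar)

lemma svar_le_norm: "svar \<gamma> A \<le> norm \<gamma>"
  using svar_mono[of A UNIV \<gamma>] by (simp add: svar_UNIV)

lemma svar_upper:
  fixes I :: "'i set"
  assumes "finite I" "disjoint_family_on B I"
    and "\<And>i. i \<in> I \<Longrightarrow> B i \<in> sets borel \<and> B i \<subseteq> A \<and> norm (v i) \<le> 1"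
  shows "norm (\<Sum>i\<in>I. blinfun_apply (measure_of_sv \<gamma> (B i)) (v i)) \<le> svar \<gamma> A"
proof -
  obtain e where e: "bij_betw e {..<card I} I"
    using ex_bij_betw_nat_finite[OF assms(1)] by (auto simp: atLeast0LessThan)
  have "(\<Sum>i\<in>I. blinfun_apply (measure_of_sv \<gamma> (B i)) (v i))
      = (\<Sum>n<card I. blinfun_apply (measure_of_sv \<gamma> (B (e n))) (v (e n)))"
    by (rule sum.reindex_bij_betw[OF e, symmetric])
  moreover have "ennreal (norm (\<Sum>n<card I. blinfun_apply (measure_of_sv \<gamma> (B (e n))) (v (e n))))
      \<le> semivariation (measure_of_sv \<gamma>) A"
  proof (rule semivariation_upper)
    show "disjoint_family_on (\<lambda>n. B (e n)) {..<card I}"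
      unfolding disjoint_family_on_def
    proof (intro ballI impI)
      fix m n assume mn: "m \<in> {..<card I}" "n \<in> {..<card I}" "m \<noteq> n"
      then have "e m \<in> I" "e n \<in> I" "e m \<noteq> e n"
        using e by (auto simp: bij_betw_def inj_on_eq_iff)
      then show "B (e m) \<inter> B (e n) = {}"
        using assms(2) unfolding disjoint_family_on_def by simp
    qed
    show "B (e n) \<in> sets borel \<and> B (e n) \<subseteq> A \<and> norm (v (e n)) \<le> 1" if "n < card I" for n
      using assms(3)[of "e n"] that e by (auto simp: bij_betw_def)
  qed
  ultimately show ?thesis by (simp add: semivariation_eq_svar)
qed

lemma svar_least:
  assumes "0 \<le> c"
    and "\<And>(m::nat) B v. disjoint_family_on B {..<m} \<Longrightarrow>
      (\<And>i. i < m \<Longrightarrow> B i \<in> sets borel \<and> B i \<subseteq> A \<and> norm (v i) \<le> 1) \<Longrightarrow>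
      norm (\<Sum>i<m. blinfun_apply (measure_of_sv \<gamma> (B i)) (v i)) \<le> c"
  shows "svar \<gamma> A \<le> c"
proof -
  have "semivariation (measure_of_sv \<gamma>) A \<le> ennreal c"
    by (intro semivariation_least ennreal_leI assms(2)) auto
  with assms(1) show ?thesis by (simp add: semivariation_eq_svar)
qed

lemma measure_of_sv_empty [simp]: "measure_of_sv \<gamma> {} = 0"
proof -
  have "(\<lambda>n::nat. measure_of_sv \<gamma> {}) sums measure_of_sv \<gamma> (\<Union>n::nat. {})"
    using measure_of_sv[of \<gamma>] unfolding additive_in_norm_def disjoint_family_on_def by auto
  then show ?thesis using summable_LIMSEQ_zero[OF sums_summable] LIMSEQ_const_iff by blast
qed

lemma svar_empty [simp]: "svar \<gamma> {} = 0"
proof -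
  have "svar \<gamma> {} \<le> 0" by (rule svar_least) (auto simp: blinfun.zero_left)
  then show ?thesis using svar_nonneg[of \<gamma> "{}"] by (rule antisym)
qed

lemma measure_of_sv_Un:
  assumes "A \<in> sets borel" "B \<in> sets borel" "A \<inter> B = {}"
  shows "measure_of_sv \<gamma> (A \<union> B) = measure_of_sv \<gamma> A + measure_of_sv \<gamma> B"
proof -
  have "disjoint_family (binaryset A B)"
    using assms(3) by (auto simp: disjoint_family_on_def binaryset_def)
  moreover have "range (binaryset A B) \<subseteq> sets borel"
    using assms by (auto simp: range_binaryset_eq)
  moreover have "additive_in_norm (measure_of_sv \<gamma>)"
    using measure_of_sv[of \<gamma>] by simp
  ultimately have "(\<lambda>n. measure_of_sv \<gamma> (binaryset A B n)) sums measure_of_sv \<gamma> (\<Union>n. binaryset A B n)"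
    unfolding additive_in_norm_def by simp
  from sums_unique2[OF this binaryset_sums[where f = "measure_of_sv \<gamma>", OF measure_of_sv_empty]] show ?thesis
    by (simp only: UN_binaryset_eq)
qed

lemma measure_of_sv_UN:
  assumes "finite I" "disjoint_family_on B I" "\<And>i. i \<in> I \<Longrightarrow> B i \<in> sets borel"
  shows "measure_of_sv \<gamma> (\<Union>i\<in>I. B i) = (\<Sum>i\<in>I. measure_of_sv \<gamma> (B i))"
  using assms
proof (induction I)
  case (insert i I)
  have "measure_of_sv \<gamma> (B i \<union> (\<Union>j\<in>I. B j)) = measure_of_sv \<gamma> (B i) + measure_of_sv \<gamma> (\<Union>j\<in>I. B j)"
    using insert by (intro measure_of_sv_Un) (auto simp: disjoint_family_on_def)
  with insert show ?case by (simp add: disjoint_family_on_insert)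
qed simp

lemma svar_Un:
  assumes "A \<in> sets borel"
  shows "svar \<gamma> (A \<union> B) \<le> svar \<gamma> A + svar \<gamma> B"
proof (rule svar_least)
  fix m :: nat and C :: "nat \<Rightarrow> 'a set" and v :: "nat \<Rightarrow> 'b"
  assume *: "disjoint_family_on C {..<m}"
    "\<And>i. i < m \<Longrightarrow> C i \<in> sets borel \<and> C i \<subseteq> A \<union> B \<and> norm (v i) \<le> 1"
  have split: "measure_of_sv \<gamma> (C i) = measure_of_sv \<gamma> (C i \<inter> A) + measure_of_sv \<gamma> (C i - A)"
    if "i < m" for i
  proof -
    have "C i = (C i \<inter> A) \<union> (C i - A)" by auto
    then show ?thesis
      using measure_of_sv_Un[of "C i \<inter> A" "C i - A" \<gamma>] *(2)[OF that] assms by auto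
  qed
  have "(\<Sum>i<m. blinfun_apply (measure_of_sv \<gamma> (C i)) (v i))
      = (\<Sum>i<m. blinfun_apply (measure_of_sv \<gamma> (C i \<inter> A)) (v i))
      + (\<Sum>i<m. blinfun_apply (measure_of_sv \<gamma> (C i - A)) (v i))"
    unfolding sum.distrib[symmetric] by (intro sum.cong refl) (simp add: split blinfun.add_left)
  also have "norm \<dots> \<le> svar \<gamma> A + svar \<gamma> B"
  proof (intro norm_triangle_mono svar_upper)
    show "disjoint_family_on (\<lambda>i. C i \<inter> A) {..<m}" "disjoint_family_on (\<lambda>i. C i - A) {..<m}"
      using *(1) by (auto simp: disjoint_family_on_def)
    show "C i \<inter> A \<in> sets borel \<and> C i \<inter> A \<subseteq> A \<and> norm (v i) \<le> 1"
      and "C i - A \<in> sets borel \<and> C i - A \<subseteq> B \<and> norm (v i) \<le> 1" if "i \<in> {..<m}" for i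
      using *(2)[of i] that assms by auto
  qed simp_all
  finally show "norm (\<Sum>i<m. blinfun_apply (measure_of_sv \<gamma> (C i)) (v i)) \<le> svar \<gamma> A + svar \<gamma> B" .
qed simp

lemma svar_plus: "svar (\<gamma> + \<delta>) A \<le> svar \<gamma> A + svar \<delta> A"
  using semivariation_add[of "measure_of_sv \<gamma>" "measure_of_sv \<delta>" A]
  by (simp add: plus_sv_measure.rep_eq[symmetric] semivariation_eq_svar ennreal_plus[symmetric] del: ennreal_plus)

lemma svar_scaleR: "svar (c *\<^sub>R \<gamma>) A \<le> \<bar>c\<bar> * svar \<gamma> A"
  using semivariation_scaleR_le[of c "measure_of_sv \<gamma>" A]
  by (simp add: scaleR_sv_measure.rep_eq[symmetric] semivariation_eq_svar ennreal_mult[symmetric])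

section \<open>Continuous semivariation\<close>

abbreviation cont_sv ::
  "('a::euclidean_space, 'v::real_normed_vector, 'w::real_normed_vector) sv_measure \<Rightarrow> bool" where
  "cont_sv \<gamma> \<equiv> continuous_semivariation (measure_of_sv \<gamma>)"

lemma svar_tendsto_0:
  assumes "\<And>n. svar \<gamma> (A n) \<le> g n" "g \<longlonglongrightarrow> 0"
  shows "(\<lambda>n. svar \<gamma> (A n)) \<longlonglongrightarrow> 0"
  by (rule Lim_null_comparison[OF _ assms(2)]) (simp add: assms(1))

lemma cont_sv_iff:
  "cont_sv \<gamma> \<longleftrightarrow>
     (\<forall>A::nat \<Rightarrow> 'a::euclidean_space set. range A \<subseteq> sets borel \<longrightarrow> decseq A \<longrightarrow> (\<Inter>n. A n) = {} \<longrightarrow>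
        (\<lambda>n. svar \<gamma> (A n)) \<longlonglongrightarrow> 0)"
proof -
  have "((\<lambda>n. ennreal (svar \<gamma> (A n))) \<longlonglongrightarrow> 0) \<longleftrightarrow> ((\<lambda>n. svar \<gamma> (A n)) \<longlonglongrightarrow> 0)"
    for A :: "nat \<Rightarrow> 'a set"
    using tendsto_ennreal_iff[where F = sequentially and f = "\<lambda>n. svar \<gamma> (A n)" and x = 0] by simp
  then show ?thesis
    unfolding continuous_semivariation_def semivariation_eq_svar by simp
qed

lemma cont_svD:
  fixes A :: "nat \<Rightarrow> 'a::euclidean_space set"
  assumes "cont_sv \<gamma>" "range A \<subseteq> sets borel" "decseq A" "(\<Inter>n. A n) = {}"
  shows "(\<lambda>n. svar \<gamma> (A n)) \<longlonglongrightarrow> 0"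
  using assms unfolding cont_sv_iff by blast

text \<open>Continuity along decreasing sequences whose intersection is only a null set.\<close>

lemma cont_sv_decseq:
  assumes "cont_sv \<gamma>" "N \<in> sets borel" "svar \<gamma> N = 0"
    and "range A \<subseteq> sets borel" "decseq A" "(\<Inter>n. A n) \<subseteq> N"
  shows "(\<lambda>n. svar \<gamma> (A n)) \<longlonglongrightarrow> 0"
proof (rule svar_tendsto_0)
  show "(\<lambda>n. svar \<gamma> (A n - N)) \<longlonglongrightarrow> 0"
    using assms(2,4-6) by (intro cont_svD[OF assms(1)]) (auto simp: decseq_def)
  fix n
  have "svar \<gamma> (A n) \<le> svar \<gamma> (N \<union> (A n - N))" by (rule svar_mono) auto
  also have "\<dots> \<le> svar \<gamma> (A n - N)"
    using svar_Un[OF assms(2), of \<gamma> "A n - N"] assms(3) by simp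
  finally show "svar \<gamma> (A n) \<le> svar \<gamma> (A n - N)" .
qed

lemma cont_sv_plus:
  assumes "cont_sv \<gamma>" "cont_sv \<delta>"
  shows "cont_sv (\<gamma> + \<delta>)"
  unfolding cont_sv_iff
proof (intro allI impI)
  fix A :: "nat \<Rightarrow> 'a set"
  assume A: "range A \<subseteq> sets borel" "decseq A" "(\<Inter>n. A n) = {}"
  have "(\<lambda>n. svar \<gamma> (A n) + svar \<delta> (A n)) \<longlonglongrightarrow> 0 + 0"
    by (intro tendsto_add cont_svD assms A)
  then show "(\<lambda>n. svar (\<gamma> + \<delta>) (A n)) \<longlonglongrightarrow> 0"
    by (intro svar_tendsto_0[OF svar_plus]) simp
qed

lemma cont_sv_scaleR:
  assumes "cont_sv \<gamma>"
  shows "cont_sv (c *\<^sub>R \<gamma>)"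
  unfolding cont_sv_iff
proof (intro allI impI)
  fix A :: "nat \<Rightarrow> 'a set"
  assume A: "range A \<subseteq> sets borel" "decseq A" "(\<Inter>n. A n) = {}"
  have "(\<lambda>n. \<bar>c\<bar> * svar \<gamma> (A n)) \<longlonglongrightarrow> \<bar>c\<bar> * 0"
    by (intro tendsto_mult_left cont_svD assms A)
  then show "(\<lambda>n. svar (c *\<^sub>R \<gamma>) (A n)) \<longlonglongrightarrow> 0"
    by (intro svar_tendsto_0[OF svar_scaleR]) simp
qed

lemma cont_sv_diff:
  assumes "cont_sv \<gamma>" "cont_sv \<delta>"
  shows "cont_sv (\<gamma> - \<delta>)"
  using cont_sv_plus[OF assms(1) cont_sv_scaleR[OF assms(2), of "-1"]] by simp

text \<open>
  Measures of continuous semivariation are closed in the semivariation norm; hence Fomin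
  derivatives inherit the property.
\<close>

lemma cont_sv_limit:
  fixes \<gamma> :: "('a::euclidean_space, 'v::real_normed_vector, 'w::real_normed_vector) sv_measure"
  assumes "(g \<longlongrightarrow> \<gamma>) F" "F \<noteq> bot" "\<forall>\<^sub>F t in F. cont_sv (g t)"
  shows "cont_sv \<gamma>"
  unfolding cont_sv_iff
proof (intro allI impI)
  fix A :: "nat \<Rightarrow> 'a set"
  assume A: "range A \<subseteq> sets borel" "decseq A" "(\<Inter>n. A n) = {}"
  show "(\<lambda>n. svar \<gamma> (A n)) \<longlonglongrightarrow> 0"
  proof (rule LIMSEQ_I)
    fix e :: real assume e: "e > 0"
    have "\<forall>\<^sub>F t in F. dist (g t) \<gamma> < e/2" using assms(1) e by (intro tendstoD) auto
    with assms(3) have "\<forall>\<^sub>F t in F. cont_sv (g t) \<and> dist (g t) \<gamma> < e/2" by eventually_elim auto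
    from eventually_happens'[OF assms(2) this]
    obtain t where t: "cont_sv (g t)" "norm (\<gamma> - g t) < e/2"
      by (auto simp: dist_norm norm_minus_commute)
    obtain m where m: "svar (g t) (A n) < e/2" if "n \<ge> m" for n
      using LIMSEQ_D[OF cont_svD[OF t(1) A], of "e/2"] e by auto
    have "svar \<gamma> (A n) < e" if "n \<ge> m" for n
    proof -
      have "svar \<gamma> (A n) \<le> svar (\<gamma> - g t) (A n) + svar (g t) (A n)"
        using svar_plus[of "\<gamma> - g t" "g t" "A n"] by simp
      also have "\<dots> < e/2 + e/2"
        using le_less_trans[OF svar_le_norm t(2)] m[OF that] by (rule add_strict_mono)
      finally show ?thesis by simp
    qed
    then show "\<exists>m. \<forall>n\<ge>m. norm (svar \<gamma> (A n) - 0) < e" by auto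
  qed
qed

lemma translation_image_eq_vimage: "(\<lambda>a. a + x) ` A = (\<lambda>a. a - x) -` A"
  for x :: "'a::group_add"
  by (auto intro!: image_eqI[of _ _ "_ - x"])

lemma svar_translate: "svar (translate x \<gamma>) A \<le> svar \<gamma> ((\<lambda>a. a + x) ` A)"
proof (rule svar_least)
  fix m :: nat and C :: "nat \<Rightarrow> 'a set" and v :: "nat \<Rightarrow> 'b"
  assume *: "disjoint_family_on C {..<m}"
    "\<And>i. i < m \<Longrightarrow> C i \<in> sets borel \<and> C i \<subseteq> A \<and> norm (v i) \<le> 1"
  show "norm (\<Sum>i<m. blinfun_apply (measure_of_sv (translate x \<gamma>) (C i)) (v i))
      \<le> svar \<gamma> ((\<lambda>a. a + x) ` A)"
    unfolding translate.rep_eq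
  proof (rule svar_upper)
    show "disjoint_family_on (\<lambda>i. (\<lambda>a. a + x) ` C i) {..<m}"
      using *(1) by (auto simp: disjoint_family_on_def translation_image_eq_vimage)
    show "(\<lambda>a. a + x) ` C i \<in> sets borel \<and> (\<lambda>a. a + x) ` C i \<subseteq> (\<lambda>a. a + x) ` A \<and> norm (v i) \<le> 1"
      if "i \<in> {..<m}" for i
      using *(2)[of i] that by (auto simp: borel_translation_iff)
  qed simp
qed simp

lemma cont_sv_translate:
  assumes "cont_sv \<gamma>"
  shows "cont_sv (translate x \<gamma>)"
  unfolding cont_sv_iff
proof (intro allI impI)
  fix A :: "nat \<Rightarrow> 'a set"
  assume A: "range A \<subseteq> sets borel" "decseq A" "(\<Inter>n. A n) = {}"
  have "(\<lambda>n. svar \<gamma> ((\<lambda>a. a + x) ` A n)) \<longlonglongrightarrow> 0"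
  proof (rule cont_svD[OF assms])
    show "range (\<lambda>n. (\<lambda>a. a + x) ` A n) \<subseteq> sets borel"
      using A(1) by (auto simp: image_subset_iff borel_translation_iff)
    show "decseq (\<lambda>n. (\<lambda>a. a + x) ` A n)"
      using A(2) by (auto simp: decseq_def)
    show "(\<Inter>n. (\<lambda>a. a + x) ` A n) = {}"
      using A(3) unfolding translation_image_eq_vimage by auto
  qed
  then show "(\<lambda>n. svar (translate x \<gamma>) (A n)) \<longlonglongrightarrow> 0"
    by (rule svar_tendsto_0[OF svar_translate])
qed

text \<open>Translation acts by linear isometries on the space of measures.\<close>

lemma translate_plus: "translate x (\<gamma> + \<delta>) = translate x \<gamma> + translate x \<delta>"
  by transfer simp

lemma translate_scaleR: "translate x (c *\<^sub>R \<gamma>) = c *\<^sub>R translate x \<gamma>"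
  by transfer simp

lemma translate_translate: "translate x (translate y \<gamma>) = translate (x + y) \<gamma>"
  by transfer (simp add: image_image add.assoc)

lemma translate_0 [simp]: "translate 0 \<gamma> = \<gamma>"
  by transfer simp

lemma bounded_linear_translate: "bounded_linear (translate x)"
proof (rule bounded_linear_intro[where K = 1])
  show "norm (translate x \<gamma>) \<le> norm \<gamma> * 1" for \<gamma> :: "('a, 'b, 'c) sv_measure"
    using order_trans[OF svar_translate svar_le_norm, of x \<gamma> UNIV] by (simp add: svar_UNIV)
qed (simp_all add: translate_plus translate_scaleR)

section \<open>Integrals of simple functions\<close>

abbreviation simple_int ::
  "('a::euclidean_space, 'v::real_normed_vector, 'w::real_normed_vector) sv_measure \<Rightarrow>
   'a set \<Rightarrow> ('a \<Rightarrow> 'v) \<Rightarrow> 'w" where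
  "simple_int \<gamma> \<equiv> simple_integral_on (measure_of_sv \<gamma>)"

lemma simple_function_finite_range: "simple_function borel s \<Longrightarrow> finite (range s)"
  using simple_functionD(1)[of borel s] by simp

lemma simple_function_vimage: "simple_function borel s \<Longrightarrow> s -` B \<in> sets borel"
  using simple_functionD(2)[of borel s B] by simp

text \<open>
  The integral may be computed on any finer partition. This reduces statements about several simple
  functions to a common partition.
\<close>

lemma simple_int_refine:
  assumes q: "simple_function borel q" and A: "A \<in> sets borel"
  shows "simple_int \<gamma> A (\<lambda>x. g (q x)) =
    (\<Sum>p\<in>range q. blinfun_apply (measure_of_sv \<gamma> (A \<inter> q -` {p})) (g p))"
proof -
  have fin: "finite (range q)" by (rule simple_function_finite_range[OF q])
  have r: "range (\<lambda>x. g (q x)) = g ` range q" by auto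
  have *: "measure_of_sv \<gamma> (A \<inter> (\<lambda>x. g (q x)) -` {v}) =
      (\<Sum>p | p \<in> range q \<and> g p = v. measure_of_sv \<gamma> (A \<inter> q -` {p}))" for v
  proof -
    have "A \<inter> (\<lambda>x. g (q x)) -` {v} = (\<Union>p\<in>{p. p \<in> range q \<and> g p = v}. A \<inter> q -` {p})" by auto
    then show ?thesis
      using fin A simple_function_vimage[OF q]
      by (simp only:) (intro measure_of_sv_UN, auto simp: disjoint_family_on_def)
  qed
  have "simple_int \<gamma> A (\<lambda>x. g (q x)) = (\<Sum>v\<in>g ` range q.
      \<Sum>p | p \<in> range q \<and> g p = v. blinfun_apply (measure_of_sv \<gamma> (A \<inter> q -` {p})) (g p))"
    unfolding simple_integral_on_def r *
    by (intro sum.cong refl) (simp add: blinfun.sum_left)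
  also have "\<dots> = (\<Sum>p\<in>range q. blinfun_apply (measure_of_sv \<gamma> (A \<inter> q -` {p})) (g p))"
    using sum.image_gen[OF fin, of "\<lambda>p. blinfun_apply (measure_of_sv \<gamma> (A \<inter> q -` {p})) (g p)" g] by simp
  finally show ?thesis .
qed

lemma simple_int_add:
  assumes "simple_function borel s" "simple_function borel t" "A \<in> sets borel"
  shows "simple_int \<gamma> A (\<lambda>x. s x + t x) = simple_int \<gamma> A s + simple_int \<gamma> A t"
proof -
  let ?q = "\<lambda>x. (s x, t x)"
  have q: "simple_function borel ?q" using assms by auto
  show ?thesis
    using simple_int_refine[OF q assms(3), of \<gamma> "\<lambda>(a, b). a + b"]
      simple_int_refine[OF q assms(3), of \<gamma> fst] simple_int_refine[OF q assms(3), of \<gamma> snd]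
    by (simp add: split_beta blinfun.add_right sum.distrib)
qed

lemma simple_int_scaleR:
  assumes "simple_function borel s" "A \<in> sets borel"
  shows "simple_int \<gamma> A (\<lambda>x. c *\<^sub>R s x) = c *\<^sub>R simple_int \<gamma> A s"
  using simple_int_refine[OF assms, of \<gamma> "\<lambda>a. c *\<^sub>R a"] simple_int_refine[OF assms, of \<gamma> "\<lambda>a. a"]
  by (simp add: blinfun.scaleR_right scaleR_sum_right)

lemma simple_int_diff:
  assumes "simple_function borel s" "simple_function borel t" "A \<in> sets borel"
  shows "simple_int \<gamma> A (\<lambda>x. s x - t x) = simple_int \<gamma> A s - simple_int \<gamma> A t"
  using simple_int_add[OF assms(1) simple_function_compose1[OF assms(2), of "\<lambda>v. (-1) *\<^sub>R v"] assms(3), of \<gamma>]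
    simple_int_scaleR[OF assms(2,3), of \<gamma> "-1"]
  by simp

lemma simple_int_Un:
  assumes "simple_function borel s" "A \<in> sets borel" "B \<in> sets borel" "A \<inter> B = {}"
  shows "simple_int \<gamma> (A \<union> B) s = simple_int \<gamma> A s + simple_int \<gamma> B s"
proof -
  have "measure_of_sv \<gamma> ((A \<union> B) \<inter> s -` {v}) =
      measure_of_sv \<gamma> (A \<inter> s -` {v}) + measure_of_sv \<gamma> (B \<inter> s -` {v})" for v
    unfolding Int_Un_distrib2 using assms simple_function_vimage[OF assms(1)]
    by (intro measure_of_sv_Un) auto
  then show ?thesis
    unfolding simple_integral_on_def by (simp add: blinfun.add_left sum.distrib)
qed

lemma simple_int_plus_measure:
  "simple_int (\<gamma> + \<delta>) A s = simple_int \<gamma> A s + simple_int \<delta> A s"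
  unfolding simple_integral_on_def plus_sv_measure.rep_eq
  by (simp add: blinfun.add_left sum.distrib)

lemma simple_int_scaleR_measure:
  "simple_int (c *\<^sub>R \<gamma>) A s = c *\<^sub>R simple_int \<gamma> A s"
  unfolding simple_integral_on_def scaleR_sv_measure.rep_eq
  by (simp add: blinfun.scaleR_left scaleR_sum_right)

lemma simple_int_translate:
  "simple_int (translate x \<gamma>) UNIV s = simple_int \<gamma> UNIV (\<lambda>y. s (y - x))"
proof -
  have "range (\<lambda>y. s (y - x)) = range s"
    by (auto intro: range_eqI[of _ _ "_ + x"])
  moreover have "(\<lambda>a. a + x) ` (s -` {v}) = (\<lambda>y. s (y - x)) -` {v}" for v
    unfolding translation_image_eq_vimage by auto
  ultimately show ?thesis
    unfolding simple_integral_on_def translate.rep_eq by simp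
qed

lemma norm_simple_int_le:
  assumes s: "simple_function borel s" and A: "A \<in> sets borel"
    and c: "0 \<le> c" "\<And>x. x \<in> A \<Longrightarrow> norm (s x) \<le> c"
  shows "norm (simple_int \<gamma> A s) \<le> c * svar \<gamma> A"
proof -
  define t where "t v = (if norm v \<le> c then inverse c *\<^sub>R v else 0)" for v :: 'b
  have fin: "finite (range s)" by (rule simple_function_finite_range[OF s])
  have "blinfun_apply (measure_of_sv \<gamma> (A \<inter> s -` {v})) v =
      c *\<^sub>R blinfun_apply (measure_of_sv \<gamma> (A \<inter> s -` {v})) (t v)" for v
  proof (cases "norm v \<le> c")
    case True
    then show ?thesis using c(1) by (cases "c = 0") (auto simp: t_def blinfun.scaleR_right)
  next
    case False
    then have "A \<inter> s -` {v} = {}" using c(2) by auto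
    then show ?thesis by (simp add: blinfun.zero_left)
  qed
  then have "simple_int \<gamma> A s =
      c *\<^sub>R (\<Sum>v\<in>range s. blinfun_apply (measure_of_sv \<gamma> (A \<inter> s -` {v})) (t v))"
    unfolding simple_integral_on_def by (simp add: scaleR_sum_right)
  moreover have "norm (\<Sum>v\<in>range s. blinfun_apply (measure_of_sv \<gamma> (A \<inter> s -` {v})) (t v)) \<le> svar \<gamma> A"
  proof (rule svar_upper[OF fin])
    show "disjoint_family_on (\<lambda>v. A \<inter> s -` {v}) (range s)"
      by (auto simp: disjoint_family_on_def)
    show "A \<inter> s -` {v} \<in> sets borel \<and> A \<inter> s -` {v} \<subseteq> A \<and> norm (t v) \<le> 1" for v
      using A simple_function_vimage[OF s] c(1) by (auto simp: t_def divide_simps)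
  qed
  ultimately show ?thesis using c(1) by (simp add: mult_left_mono)
qed

text \<open>The estimate behind all limit theorems: \<open>s\<close> is small off \<open>U\<close>, and \<open>U\<close> has small semivariation.\<close>

lemma norm_simple_int_split_le:
  assumes s: "simple_function borel s" and U: "U \<in> sets borel" "A \<in> sets borel"
    and c: "0 \<le> c" "\<And>x. x \<in> A \<Longrightarrow> x \<notin> U \<Longrightarrow> norm (s x) \<le> c"
    and M: "0 \<le> M" "\<And>x. norm (s x) \<le> M"
  shows "norm (simple_int \<gamma> A s) \<le> c * norm \<gamma> + M * svar \<gamma> U"
proof -
  have "A = (A - U) \<union> (A \<inter> U)" by auto
  then have "simple_int \<gamma> A s = simple_int \<gamma> (A - U) s + simple_int \<gamma> (A \<inter> U) s"
    using simple_int_Un[OF s, of "A - U" "A \<inter> U" \<gamma>] U by auto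
  moreover have "norm (simple_int \<gamma> (A - U) s) \<le> c * svar \<gamma> (A - U)"
    using assms by (intro norm_simple_int_le) auto
  moreover have "norm (simple_int \<gamma> (A \<inter> U) s) \<le> M * svar \<gamma> (A \<inter> U)"
    using assms by (intro norm_simple_int_le) auto
  moreover have "c * svar \<gamma> (A - U) \<le> c * norm \<gamma>" "M * svar \<gamma> (A \<inter> U) \<le> M * svar \<gamma> U"
    using c(1) M(1) by (auto intro!: mult_left_mono svar_le_norm svar_mono)
  ultimately show ?thesis
    by (smt (verit) norm_triangle_ineq)
qed

section \<open>Uniqueness of the Dobrakov integral\<close>

lemma simple_function_bounded:
  fixes s :: "'a::topological_space \<Rightarrow> 'b::real_normed_vector"
  assumes "simple_function borel s"
  obtains b where "0 \<le> b" "\<And>x. norm (s x) \<le> b"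
proof -
  have "bounded (range s)"
    using simple_function_finite_range[OF assms] by (rule finite_imp_bounded)
  then obtain b where b: "\<And>x. norm (s x) \<le> b" unfolding bounded_iff by auto
  show thesis by (rule that[OF order_trans[OF norm_ge_zero b] b])
qed

text \<open>
  The gliding hump. If the integrals over the whole space stayed away from \<open>0\<close>, one could choose indices
  \<open>m\<^sub>0 < m\<^sub>1 < \<dots>\<close> and disjoint sets \<open>G\<^sub>i\<close> such that the integral of \<open>r m\<^sub>i\<close> lives on \<open>G\<^sub>i\<close> up to a small
  error. Over the union of the \<open>G\<^sub>i\<close> with even \<open>i\<close>, the integrals would then be alternately large and
  small.
\<close>

lemma dobrakov_null_sequence:
  fixes \<gamma> :: "('a::euclidean_space, 'v::real_normed_vector, 'w::real_normed_vector) sv_measure"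
  assumes cont: "cont_sv \<gamma>"
    and r: "\<And>n. simple_function borel (r n)"
    and N: "N \<in> sets borel" "svar \<gamma> N = 0"
    and lim: "\<And>x. x \<notin> N \<Longrightarrow> (\<lambda>n. r n x) \<longlonglongrightarrow> 0"
    and conv: "\<And>A. A \<in> sets borel \<Longrightarrow> convergent (\<lambda>n. simple_int \<gamma> A (r n))"
    and w: "(\<lambda>n. simple_int \<gamma> UNIV (r n)) \<longlonglongrightarrow> w"
  shows "w = 0"
proof (rule ccontr)
  assume "w \<noteq> 0"
  \<comment> \<open>The final estimate splits \<open>w\<close> into five terms of total norm less than \<open>8 * \<delta>\<close>.\<close>
  define \<delta> where "\<delta> = norm w / 8"
  define \<epsilon> where "\<epsilon> = \<delta> / (norm \<gamma> + 1)"
  have \<delta>: "\<delta> > 0" using \<open>w \<noteq> 0\<close> by (simp add: \<delta>_def)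
  have \<epsilon>: "\<epsilon> > 0" "\<epsilon> * norm \<gamma> \<le> \<delta>"
  proof -
    have pos: "norm \<gamma> + 1 > 0" by (simp add: add_nonneg_pos)
    show "\<epsilon> > 0" using \<delta> pos by (simp add: \<epsilon>_def)
    have "\<epsilon> * norm \<gamma> \<le> \<epsilon> * (norm \<gamma> + 1)" using \<open>\<epsilon> > 0\<close> by simp
    also have "\<dots> = \<delta>" using pos by (simp add: \<epsilon>_def)
    finally show "\<epsilon> * norm \<gamma> \<le> \<delta>" .
  qed
  \<comment> \<open>From index \<open>m\<close> on, all \<open>r n\<close> are at most \<open>\<epsilon>\<close> off \<open>F m\<close>.\<close>
  define F where "F m = (\<Union>n\<in>{m..}. r n -` {v. \<epsilon> < norm v})" for m
  have F_borel: "F m \<in> sets borel" for m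
    unfolding F_def by (intro sets.countable_UN'' simple_function_vimage[OF r] countableI_type)
  have F_decseq: "decseq F"
    unfolding F_def decseq_def by (auto intro: order_trans)
  have "(\<Inter>m. F m) \<subseteq> N"
  proof
    fix x assume x: "x \<in> (\<Inter>m. F m)"
    show "x \<in> N"
    proof (rule ccontr)
      assume "x \<notin> N"
      from LIMSEQ_D[OF lim[OF this] \<epsilon>(1)] obtain m where "\<And>n. n \<ge> m \<Longrightarrow> norm (r n x) < \<epsilon>" by auto
      moreover from x have "x \<in> F m" by auto
      ultimately show False unfolding F_def by fastforce
    qed
  qed
  then have F_null: "(\<lambda>m. svar \<gamma> (F m)) \<longlonglongrightarrow> 0"
    using F_borel F_decseq by (intro cont_sv_decseq[OF cont N]) auto
  have "\<exists>b. 0 \<le> b \<and> (\<forall>x. norm (r n x) \<le> b)" for n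
    using simple_function_bounded[OF r[of n]] by auto
  then obtain b where b: "\<And>n. 0 \<le> b n" "\<And>n x. norm (r n x) \<le> b n"
    by metis
  \<comment> \<open>Each \<open>r m\<close> is bounded, so its integral is negligible on \<open>F m'\<close> for large \<open>m'\<close>.\<close>
  have "\<exists>m'>m. b m * svar \<gamma> (F m') \<le> \<delta>" for m
  proof -
    have "(\<lambda>m'. b m * svar \<gamma> (F m')) \<longlonglongrightarrow> b m * 0" by (intro tendsto_mult_left F_null)
    then have "(\<lambda>m'. b m * svar \<gamma> (F m')) \<longlonglongrightarrow> 0" by simp
    from LIMSEQ_D[OF this \<delta>] obtain k where k: "\<And>n. n \<ge> k \<Longrightarrow> norm (b m * svar \<gamma> (F n)) < \<delta>"
      by auto
    have "\<bar>b m * svar \<gamma> (F (max k (Suc m)))\<bar> < \<delta>" using k[of "max k (Suc m)"] by simp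
    then show ?thesis by (intro exI[of _ "max k (Suc m)"]) auto
  qed
  then obtain q where q: "\<And>m. m < q m" "\<And>m. b m * svar \<gamma> (F (q m)) \<le> \<delta>" by metis
  obtain m0 where m0: "\<And>m. m \<ge> m0 \<Longrightarrow> norm (simple_int \<gamma> UNIV (r m) - w) < \<delta>"
    using LIMSEQ_D[OF w \<delta>] by auto
  define ms where "ms i = (q ^^ i) m0" for i
  have ms_Suc: "ms (Suc i) = q (ms i)" for i by (simp add: ms_def)
  have ms_mono: "strict_mono ms" by (simp add: strict_mono_Suc_iff ms_Suc q)
  have ms_ge: "m0 \<le> ms i" for i
    using strict_mono_less_eq[OF ms_mono, of 0 i] by (simp add: ms_def)
  define G where "G i = F (ms i) - F (ms (Suc i))" for i
  have F_mono: "F (ms j) \<subseteq> F (ms i)" if "i \<le> j" for i j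
    using F_decseq strict_mono_less_eq[OF ms_mono] that unfolding decseq_def by simp
  \<comment> \<open>Only the part of \<open>A\<close> in \<open>G i\<close> matters for the integral of \<open>r (ms i)\<close>: off \<open>F (ms i)\<close> the
      integrand is at most \<open>\<epsilon>\<close>, and \<open>F (ms (Suc i))\<close> has very small semivariation.\<close>
  have hump: "norm (simple_int \<gamma> A (r (ms i)) - simple_int \<gamma> (A \<inter> G i) (r (ms i))) \<le> 2 * \<delta>"
    if A: "A \<in> sets borel" for A i
  proof -
    let ?r = "r (ms i)" and ?A = "A - F (ms i)" and ?B = "A \<inter> F (ms (Suc i))"
    have sets: "?A \<in> sets borel" "?B \<in> sets borel" "A \<inter> G i \<in> sets borel"
      using A F_borel by (auto simp: G_def)
    have "?A \<inter> ?B = {}" "(?A \<union> ?B) \<inter> (A \<inter> G i) = {}"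
      using F_mono[of i "Suc i"] by (auto simp: G_def)
    then have "simple_int \<gamma> ((?A \<union> ?B) \<union> (A \<inter> G i)) ?r
        = simple_int \<gamma> ?A ?r + simple_int \<gamma> ?B ?r + simple_int \<gamma> (A \<inter> G i) ?r"
      using sets by (simp add: simple_int_Un r del: Int_Un_distrib Int_Un_distrib2)
    moreover have "(?A \<union> ?B) \<union> (A \<inter> G i) = A"
      using F_mono[of i "Suc i"] by (auto simp: G_def)
    ultimately have "simple_int \<gamma> A ?r - simple_int \<gamma> (A \<inter> G i) ?r
        = simple_int \<gamma> ?A ?r + simple_int \<gamma> ?B ?r"
      by simp
    also have "norm \<dots> \<le> \<delta> + \<delta>"
    proof (rule norm_triangle_mono)
      have "norm (simple_int \<gamma> ?A ?r) \<le> \<epsilon> * svar \<gamma> ?A"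
      proof (rule norm_simple_int_le[OF r sets(1)])
        show "norm (?r x) \<le> \<epsilon>" if "x \<in> ?A" for x
          using that unfolding F_def by fastforce
      qed (use \<epsilon> in simp)
      also have "\<dots> \<le> \<epsilon> * norm \<gamma>" using \<epsilon>(1) by (simp add: svar_le_norm)
      finally show "norm (simple_int \<gamma> ?A ?r) \<le> \<delta>" using \<epsilon>(2) by simp
      have "norm (simple_int \<gamma> ?B ?r) \<le> b (ms i) * svar \<gamma> ?B"
        by (rule norm_simple_int_le[OF r sets(2) b])
      also have "\<dots> \<le> b (ms i) * svar \<gamma> (F (ms (Suc i)))"
        by (intro mult_left_mono svar_mono b) auto
      also have "\<dots> \<le> \<delta>" using q(2)[of "ms i"] by (simp add: ms_Suc)
      finally show "norm (simple_int \<gamma> ?B ?r) \<le> \<delta>" .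
    qed
    finally show ?thesis by simp
  qed
  define S where "S = (\<Union>i. G (2 * i))"
  have S: "S \<in> sets borel"
    unfolding S_def G_def using F_borel by auto
  have G_disj: "G i \<inter> G j = {}" if "i < j" for i j
    using F_mono[of "Suc i" j] that unfolding G_def by auto
  have S_even: "S \<inter> G (2 * i) = G (2 * i)" for i
    unfolding S_def by auto
  have S_odd: "S \<inter> G (Suc (2 * i)) = {}" for i
  proof -
    have "G (2 * j) \<inter> G (Suc (2 * i)) = {}" for j
      using G_disj[of "2 * j" "Suc (2 * i)"] G_disj[of "Suc (2 * i)" "2 * j"]
      by (cases "j \<le> i") auto
    then show ?thesis unfolding S_def by auto
  qed
  from conv[OF S] have "Cauchy (\<lambda>n. simple_int \<gamma> S (r n))"
    by (rule convergent_Cauchy)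
  from CauchyD[OF this \<delta>] obtain M where
    M: "\<And>m n. m \<ge> M \<Longrightarrow> n \<ge> M \<Longrightarrow> norm (simple_int \<gamma> S (r m) - simple_int \<gamma> S (r n)) < \<delta>" by auto
  have ge: "ms (2 * M) \<ge> M" "ms (Suc (2 * M)) \<ge> M"
    using seq_suble[OF ms_mono, of "2 * M"] seq_suble[OF ms_mono, of "Suc (2 * M)"] by auto
  define a where "a = simple_int \<gamma> S (r (ms (2 * M)))"
  define c where "c = simple_int \<gamma> S (r (ms (Suc (2 * M))))"
  define u where "u = simple_int \<gamma> UNIV (r (ms (2 * M)))"
  define g where "g = simple_int \<gamma> (G (2 * M)) (r (ms (2 * M)))"
  have "norm (a - c) < \<delta>" unfolding a_def c_def by (rule M[OF ge])
  moreover have "norm (a - g) \<le> 2 * \<delta>"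
    using hump[OF S, of "2 * M"] unfolding S_even a_def g_def .
  moreover have "norm (u - g) \<le> 2 * \<delta>"
    using hump[of UNIV "2 * M"] unfolding u_def g_def by simp
  moreover have "norm c \<le> 2 * \<delta>"
    using hump[OF S, of "Suc (2 * M)"] unfolding S_odd c_def
    by (simp add: simple_integral_on_def blinfun.zero_left)
  moreover have "norm (u - w) < \<delta>" unfolding u_def by (rule m0[OF ms_ge])
  moreover have "norm w \<le> norm (u - w) + norm (u - g) + norm (a - g) + norm (a - c) + norm c"
  proof -
    have "w = - (u - w) + (u - g) + - (a - g) + (a - c) + c" by simp
    also have "norm \<dots> \<le> norm (u - w) + norm (u - g) + norm (a - g) + norm (a - c) + norm c"
      by (intro norm_triangle_mono; simp only: norm_minus_cancel order_refl)
    finally show ?thesis .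
  qed
  ultimately show False using \<delta> by (simp add: \<delta>_def)
qed

lemma has_dobrakov_integral_unique:
  assumes cont: "cont_sv \<gamma>"
    and I: "has_dobrakov_integral (measure_of_sv \<gamma>) UNIV f I"
    and J: "has_dobrakov_integral (measure_of_sv \<gamma>) UNIV f J"
  shows "I = J"
proof -
  obtain s N where s: "\<And>n. simple_function borel (s n)" "N \<in> sets borel" "svar \<gamma> N = 0"
      "\<And>x. x \<notin> N \<Longrightarrow> (\<lambda>n. s n x) \<longlonglongrightarrow> f x"
      "\<And>A. A \<in> sets borel \<Longrightarrow> convergent (\<lambda>n. simple_int \<gamma> A (s n))"
      "(\<lambda>n. simple_int \<gamma> UNIV (s n)) \<longlonglongrightarrow> I"
    using I unfolding has_dobrakov_integral_def dobrakov_approx_def semivariation_eq_svar by auto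
  obtain t L where t: "\<And>n. simple_function borel (t n)" "L \<in> sets borel" "svar \<gamma> L = 0"
      "\<And>x. x \<notin> L \<Longrightarrow> (\<lambda>n. t n x) \<longlonglongrightarrow> f x"
      "\<And>A. A \<in> sets borel \<Longrightarrow> convergent (\<lambda>n. simple_int \<gamma> A (t n))"
      "(\<lambda>n. simple_int \<gamma> UNIV (t n)) \<longlonglongrightarrow> J"
    using J unfolding has_dobrakov_integral_def dobrakov_approx_def semivariation_eq_svar by auto
  have diff: "simple_int \<gamma> A (\<lambda>x. s n x - t n x) = simple_int \<gamma> A (s n) - simple_int \<gamma> A (t n)"
    if "A \<in> sets borel" for A n
    by (rule simple_int_diff[OF s(1) t(1) that])
  have "I - J = 0"
  proof (rule dobrakov_null_sequence[OF cont, where r = "\<lambda>n x. s n x - t n x" and N = "N \<union> L"])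
    show "simple_function borel (\<lambda>x. s n x - t n x)" for n
      by (rule simple_function_compose2[OF s(1) t(1)])
    show "N \<union> L \<in> sets borel" using s(2) t(2) by auto
    show "svar \<gamma> (N \<union> L) = 0"
      using svar_Un[OF s(2), of \<gamma> L] s(3) t(3) svar_nonneg[of \<gamma> "N \<union> L"] by linarith
    show "(\<lambda>n. s n x - t n x) \<longlonglongrightarrow> 0" if "x \<notin> N \<union> L" for x
      using tendsto_diff[OF s(4)[of x] t(4)[of x]] that by simp
    show "convergent (\<lambda>n. simple_int \<gamma> A (\<lambda>x. s n x - t n x))" if "A \<in> sets borel" for A
      unfolding diff[OF that] by (intro convergent_diff s(5) t(5) that)
    show "(\<lambda>n. simple_int \<gamma> UNIV (\<lambda>x. s n x - t n x)) \<longlonglongrightarrow> I - J"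
      using tendsto_diff[OF s(6) t(6)] by (simp add: diff)
  qed
  then show ?thesis by simp
qed

section \<open>Integrals of bounded continuous functions\<close>

abbreviation dint ::
  "('a::euclidean_space, 'v::real_normed_vector, 'w::real_normed_vector) sv_measure \<Rightarrow>
   ('a \<Rightarrow> 'v) \<Rightarrow> 'w" where
  "dint \<gamma> \<equiv> dobrakov_integral \<gamma> UNIV"

text \<open>
  An Egoroff argument: bounded simple functions that converge pointwise are uniformly Cauchy off sets
  of arbitrarily small semivariation. No measurability of the limit \<open>g\<close> is involved.
\<close>

lemma convergent_simple_int:
  fixes \<gamma> :: "('a::euclidean_space, 'v::real_normed_vector, 'w::banach) sv_measure"
  assumes cont: "cont_sv \<gamma>"
    and s: "\<And>n. simple_function borel (s n)"
    and M: "\<And>n x. norm (s n x) \<le> M"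
    and lim: "\<And>x. (\<lambda>n. s n x) \<longlonglongrightarrow> g x"
    and A: "A \<in> sets borel"
  shows "convergent (\<lambda>n. simple_int \<gamma> A (s n))"
proof (rule Cauchy_convergent, rule CauchyI)
  fix e :: real assume e: "e > 0"
  have M0: "0 \<le> M" using order_trans[OF norm_ge_zero M] .
  define \<epsilon> where "\<epsilon> = e / (2 * (norm \<gamma> + 1))"
  have pos: "norm \<gamma> + 1 > 0" by (simp add: add_nonneg_pos)
  then have \<epsilon>: "\<epsilon> > 0" using e by (simp add: \<epsilon>_def)
  have "\<epsilon> * norm \<gamma> \<le> \<epsilon> * (norm \<gamma> + 1)" using \<epsilon> by simp
  also have "\<dots> = e / 2" using pos by (simp add: \<epsilon>_def field_simps)
  finally have \<epsilon>2: "\<epsilon> * norm \<gamma> \<le> e / 2" .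
  define F where "F m = (\<Union>i\<in>{m..}. \<Union>j\<in>{m..}. (\<lambda>x. s i x - s j x) -` {v. \<epsilon> < norm v})" for m
  have sub: "simple_function borel (\<lambda>x. s i x - s j x)" for i j
    by (rule simple_function_compose2[OF s s])
  have F_borel: "F m \<in> sets borel" for m
    unfolding F_def by (intro sets.countable_UN'' simple_function_vimage[OF sub] countableI_type)
  have "decseq F"
    unfolding F_def decseq_def by (auto intro: order_trans)
  moreover have "(\<Inter>m. F m) = {}"
  proof (rule ccontr)
    assume "(\<Inter>m. F m) \<noteq> {}"
    then obtain x where x: "\<And>m. x \<in> F m" by auto
    have "Cauchy (\<lambda>n. s n x)" using lim[of x] by (intro convergent_Cauchy convergentI)
    from CauchyD[OF this \<epsilon>] obtain m where
      "\<And>i j. i \<ge> m \<Longrightarrow> j \<ge> m \<Longrightarrow> norm (s i x - s j x) < \<epsilon>" by auto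
    with x[of m] show False unfolding F_def by fastforce
  qed
  ultimately have "(\<lambda>m. svar \<gamma> (F m)) \<longlonglongrightarrow> 0"
    using F_borel by (intro cont_svD[OF cont]) auto
  then have "(\<lambda>m. 2 * M * svar \<gamma> (F m)) \<longlonglongrightarrow> 0"
    by (rule tendsto_mult_right_zero)
  then have "\<forall>\<^sub>F m in sequentially. 2 * M * svar \<gamma> (F m) < e / 2"
    by (rule order_tendstoD(2)) (use e in simp)
  then obtain m where m: "2 * M * svar \<gamma> (F m) < e / 2"
    using eventually_happens'[OF sequentially_bot] by auto
  have "norm (simple_int \<gamma> A (s i) - simple_int \<gamma> A (s j)) < e" if ij: "i \<ge> m" "j \<ge> m" for i j
  proof -
    have "simple_int \<gamma> A (s i) - simple_int \<gamma> A (s j) = simple_int \<gamma> A (\<lambda>x. s i x - s j x)"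
      by (rule simple_int_diff[OF s s A, symmetric])
    also have "norm \<dots> \<le> \<epsilon> * norm \<gamma> + 2 * M * svar \<gamma> (F m)"
    proof (rule norm_simple_int_split_le[OF sub F_borel A])
      show "norm (s i x - s j x) \<le> \<epsilon>" if "x \<notin> F m" for x
        using that ij unfolding F_def by fastforce
      show "norm (s i x - s j x) \<le> 2 * M" for x
        using norm_triangle_ineq4[of "s i x" "s j x"] M[of i x] M[of j x] by linarith
    qed (use \<epsilon> M0 in auto)
    also have "\<dots> < e / 2 + e / 2" using \<epsilon>2 m by (rule add_le_less_mono)
    finally show ?thesis by simp
  qed
  then show "\<exists>m. \<forall>i\<ge>m. \<forall>j\<ge>m. norm (simple_int \<gamma> A (s i) - simple_int \<gamma> A (s j)) < e" by blast
qed

text \<open>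
  Such a sequence therefore defines the Dobrakov integral of its limit; uniqueness of the integral
  makes the definite description meaningful.
\<close>

lemma dint_limit:
  fixes \<gamma> :: "('a::euclidean_space, 'v::real_normed_vector, 'w::banach) sv_measure"
  assumes cont: "cont_sv \<gamma>"
    and s: "\<And>n. simple_function borel (s n)"
    and M: "\<And>n x. norm (s n x) \<le> M"
    and lim: "\<And>x. (\<lambda>n. s n x) \<longlonglongrightarrow> g x"
  shows "(\<lambda>n. simple_int \<gamma> UNIV (s n)) \<longlonglongrightarrow> dint \<gamma> g"
proof -
  have conv: "convergent (\<lambda>n. simple_int \<gamma> A (s n))" if "A \<in> sets borel" for A
    by (rule convergent_simple_int[OF cont s M lim that])
  have null: "semivariation (measure_of_sv \<gamma>) {} = 0"
    by (simp add: semivariation_eq_svar)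
  have "dobrakov_approx (measure_of_sv \<gamma>) g s"
    unfolding dobrakov_approx_def using s lim conv null by (intro conjI bexI[of _ "{}"]) auto
  moreover obtain I where I: "(\<lambda>n. simple_int \<gamma> UNIV (s n)) \<longlonglongrightarrow> I"
    using conv[of UNIV] by (auto simp: convergent_def)
  ultimately have *: "has_dobrakov_integral (measure_of_sv \<gamma>) UNIV g I"
    unfolding has_dobrakov_integral_def by blast
  have "dint \<gamma> g = I"
    unfolding dobrakov_integral_def
    by (rule the_equality) (rule *, rule has_dobrakov_integral_unique[OF cont _ *])
  with I show ?thesis by simp
qed

text \<open>Bounded continuous functions: the integrands for which integrals are computed below.\<close>

definition bounded_continuous :: "('a::topological_space \<Rightarrow> 'b::real_normed_vector) \<Rightarrow> bool" where
  "bounded_continuous g \<longleftrightarrow> continuous_on UNIV g \<and> (\<exists>M. \<forall>x. norm (g x) \<le> M)"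

text \<open>
  The values need not be separable, so measurability of \<open>g\<close> does not provide the approximation
  directly; instead \<open>g\<close> is composed with simple functions that approximate the identity.
\<close>

lemma simple_identity_approximation:
  obtains p :: "nat \<Rightarrow> 'a::euclidean_space \<Rightarrow> 'a"
  where "\<And>n. simple_function borel (p n)" "\<And>x. (\<lambda>n. p n x) \<longlonglongrightarrow> x"
proof -
  obtain p :: "nat \<Rightarrow> 'a \<Rightarrow> 'a" where
    "\<forall>i. simple_function borel (p i)" "\<forall>x. (\<lambda>i. p i x) \<longlonglongrightarrow> x"
    using borel_measurable_implies_sequence_metric[of "\<lambda>x::'a. x" borel 0] by auto
  then show thesis by (intro that[of p]) auto
qed

lemma bounded_continuous_approx:
  fixes g :: "'a::euclidean_space \<Rightarrow> 'b::real_normed_vector"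
  assumes "bounded_continuous g"
  obtains s M where "\<And>n. simple_function borel (s n)" "\<And>n x. norm (s n x) \<le> M"
    "\<And>x. (\<lambda>n. s n x) \<longlonglongrightarrow> g x"
proof -
  obtain M where M: "\<And>x. norm (g x) \<le> M" and g: "continuous_on UNIV g"
    using assms unfolding bounded_continuous_def by auto
  obtain p :: "nat \<Rightarrow> 'a \<Rightarrow> 'a" where p: "\<And>n. simple_function borel (p n)" "\<And>x. (\<lambda>n. p n x) \<longlonglongrightarrow> x"
    by (rule simple_identity_approximation) auto
  show thesis
  proof (rule that)
    show "simple_function borel (\<lambda>x. g (p n x))" for n by (rule simple_function_compose1[OF p(1)])
    show "norm (g (p n x)) \<le> M" for n x by (rule M)
    show "(\<lambda>n. g (p n x)) \<longlonglongrightarrow> g x" for x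
      using continuous_on_tendsto_compose[OF g p(2)] by simp
  qed
qed

lemma dint_add:
  fixes \<gamma> :: "('a::euclidean_space, 'v::real_normed_vector, 'w::banach) sv_measure"
  assumes "cont_sv \<gamma>" "bounded_continuous f" "bounded_continuous g"
  shows "dint \<gamma> (\<lambda>x. f x + g x) = dint \<gamma> f + dint \<gamma> g"
proof -
  obtain s M where s: "\<And>n. simple_function borel (s n)" "\<And>n x. norm (s n x) \<le> M" "\<And>x. (\<lambda>n. s n x) \<longlonglongrightarrow> f x"
    using bounded_continuous_approx[OF assms(2)] by blast
  obtain t L where t: "\<And>n. simple_function borel (t n)" "\<And>n x. norm (t n x) \<le> L" "\<And>x. (\<lambda>n. t n x) \<longlonglongrightarrow> g x"
    using bounded_continuous_approx[OF assms(3)] by blast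
  have "(\<lambda>n. simple_int \<gamma> UNIV (\<lambda>x. s n x + t n x)) \<longlonglongrightarrow> dint \<gamma> (\<lambda>x. f x + g x)"
  proof (rule dint_limit[OF assms(1)])
    show "simple_function borel (\<lambda>x. s n x + t n x)" for n
      by (rule simple_function_compose2[OF s(1) t(1)])
    show "norm (s n x + t n x) \<le> M + L" for n x by (rule norm_triangle_mono[OF s(2) t(2)])
    show "(\<lambda>n. s n x + t n x) \<longlonglongrightarrow> f x + g x" for x by (rule tendsto_add[OF s(3) t(3)])
  qed
  moreover have "(\<lambda>n. simple_int \<gamma> UNIV (\<lambda>x. s n x + t n x)) \<longlonglongrightarrow> dint \<gamma> f + dint \<gamma> g"
    using tendsto_add[OF dint_limit[OF assms(1) s] dint_limit[OF assms(1) t]]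
    by (simp add: simple_int_add[OF s(1) t(1)])
  ultimately show ?thesis by (rule LIMSEQ_unique)
qed

lemma dint_scaleR:
  fixes \<gamma> :: "('a::euclidean_space, 'v::real_normed_vector, 'w::banach) sv_measure"
  assumes "cont_sv \<gamma>" "bounded_continuous f"
  shows "dint \<gamma> (\<lambda>x. c *\<^sub>R f x) = c *\<^sub>R dint \<gamma> f"
proof -
  obtain s M where s: "\<And>n. simple_function borel (s n)" "\<And>n x. norm (s n x) \<le> M" "\<And>x. (\<lambda>n. s n x) \<longlonglongrightarrow> f x"
    using bounded_continuous_approx[OF assms(2)] by blast
  have "(\<lambda>n. simple_int \<gamma> UNIV (\<lambda>x. c *\<^sub>R s n x)) \<longlonglongrightarrow> dint \<gamma> (\<lambda>x. c *\<^sub>R f x)"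
  proof (rule dint_limit[OF assms(1)])
    show "simple_function borel (\<lambda>x. c *\<^sub>R s n x)" for n
      by (rule simple_function_compose1[OF s(1)])
    show "norm (c *\<^sub>R s n x) \<le> \<bar>c\<bar> * M" for n x using s(2) by (simp add: mult_left_mono)
    show "(\<lambda>n. c *\<^sub>R s n x) \<longlonglongrightarrow> c *\<^sub>R f x" for x by (intro tendsto_scaleR tendsto_const s(3))
  qed
  moreover have "(\<lambda>n. simple_int \<gamma> UNIV (\<lambda>x. c *\<^sub>R s n x)) \<longlonglongrightarrow> c *\<^sub>R dint \<gamma> f"
    using tendsto_scaleR[OF tendsto_const dint_limit[OF assms(1) s], of c]
    by (simp add: simple_int_scaleR[OF s(1)])
  ultimately show ?thesis by (rule LIMSEQ_unique)
qed

lemma bounded_continuous_scaleR: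
  "bounded_continuous f \<Longrightarrow> bounded_continuous (\<lambda>x. c *\<^sub>R f x)"
  unfolding bounded_continuous_def
proof safe
  fix M assume "\<forall>x. norm (f x) \<le> M"
  then show "\<exists>M. \<forall>x. norm (c *\<^sub>R f x) \<le> M"
    by (intro exI[of _ "\<bar>c\<bar> * M"]) (simp add: mult_left_mono)
qed (intro continuous_intros)

lemma bounded_continuous_add:
  assumes "bounded_continuous f" "bounded_continuous g"
  shows "bounded_continuous (\<lambda>x. f x + g x)"
proof -
  obtain M L where *: "\<And>x. norm (f x) \<le> M" "\<And>x. norm (g x) \<le> L"
    using assms unfolding bounded_continuous_def by auto
  have "norm (f x + g x) \<le> M + L" for x by (rule norm_triangle_mono[OF *])
  then show ?thesis
    using assms unfolding bounded_continuous_def by (auto intro!: continuous_intros)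
qed

lemma bounded_continuous_diff:
  assumes "bounded_continuous f" "bounded_continuous g"
  shows "bounded_continuous (\<lambda>x. f x - g x)"
  using bounded_continuous_add[OF assms(1) bounded_continuous_scaleR[OF assms(2), of "-1"]] by simp

lemma dint_diff:
  fixes \<gamma> :: "('a::euclidean_space, 'v::real_normed_vector, 'w::banach) sv_measure"
  assumes "cont_sv \<gamma>" "bounded_continuous f" "bounded_continuous g"
  shows "dint \<gamma> (\<lambda>x. f x - g x) = dint \<gamma> f - dint \<gamma> g"
  using dint_add[OF assms(1,2) bounded_continuous_scaleR[OF assms(3), of "-1"]]
    dint_scaleR[OF assms(1,3), of "-1"] by simp

lemma dint_plus_measure:
  fixes \<gamma> :: "('a::euclidean_space, 'v::real_normed_vector, 'w::banach) sv_measure"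
  assumes "cont_sv \<gamma>" "cont_sv \<delta>" "bounded_continuous f"
  shows "dint (\<gamma> + \<delta>) f = dint \<gamma> f + dint \<delta> f"
proof -
  obtain s M where s: "\<And>n. simple_function borel (s n)" "\<And>n x. norm (s n x) \<le> M" "\<And>x. (\<lambda>n. s n x) \<longlonglongrightarrow> f x"
    using bounded_continuous_approx[OF assms(3)] by blast
  have "(\<lambda>n. simple_int (\<gamma> + \<delta>) UNIV (s n)) \<longlonglongrightarrow> dint \<gamma> f + dint \<delta> f"
    unfolding simple_int_plus_measure
    by (rule tendsto_add[OF dint_limit[OF assms(1) s] dint_limit[OF assms(2) s]])
  then show ?thesis
    by (rule LIMSEQ_unique[OF dint_limit[OF cont_sv_plus[OF assms(1,2)] s]])
qed

lemma dint_scaleR_measure: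
  fixes \<gamma> :: "('a::euclidean_space, 'v::real_normed_vector, 'w::banach) sv_measure"
  assumes "cont_sv \<gamma>" "bounded_continuous f"
  shows "dint (c *\<^sub>R \<gamma>) f = c *\<^sub>R dint \<gamma> f"
proof -
  obtain s M where s: "\<And>n. simple_function borel (s n)" "\<And>n x. norm (s n x) \<le> M" "\<And>x. (\<lambda>n. s n x) \<longlonglongrightarrow> f x"
    using bounded_continuous_approx[OF assms(2)] by blast
  have "(\<lambda>n. simple_int (c *\<^sub>R \<gamma>) UNIV (s n)) \<longlonglongrightarrow> c *\<^sub>R dint \<gamma> f"
    unfolding simple_int_scaleR_measure
    by (rule tendsto_scaleR[OF tendsto_const dint_limit[OF assms(1) s]])
  then show ?thesis
    by (rule LIMSEQ_unique[OF dint_limit[OF cont_sv_scaleR[OF assms(1)] s]])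
qed

lemma dint_diff_measure:
  fixes \<gamma> :: "('a::euclidean_space, 'v::real_normed_vector, 'w::banach) sv_measure"
  assumes "cont_sv \<gamma>" "cont_sv \<delta>" "bounded_continuous f"
  shows "dint (\<gamma> - \<delta>) f = dint \<gamma> f - dint \<delta> f"
  using dint_plus_measure[OF assms(1) cont_sv_scaleR[OF assms(2), of "-1"] assms(3)]
    dint_scaleR_measure[OF assms(2,3), of "-1"] by simp

lemma dint_translate:
  fixes \<gamma> :: "('a::euclidean_space, 'v::real_normed_vector, 'w::banach) sv_measure"
  assumes "cont_sv \<gamma>" "bounded_continuous f"
  shows "dint (translate x \<gamma>) f = dint \<gamma> (\<lambda>y. f (y - x))"
proof -
  obtain s M where s: "\<And>n. simple_function borel (s n)" "\<And>n x. norm (s n x) \<le> M" "\<And>x. (\<lambda>n. s n x) \<longlonglongrightarrow> f x"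
    using bounded_continuous_approx[OF assms(2)] by blast
  have "(\<lambda>n. simple_int \<gamma> UNIV (\<lambda>y. s n (y - x))) \<longlonglongrightarrow> dint \<gamma> (\<lambda>y. f (y - x))"
  proof (rule dint_limit[OF assms(1)])
    have "(\<lambda>y. y - x) \<in> measurable borel borel" by measurable
    then show "simple_function borel (\<lambda>y. s n (y - x))" for n
      using s(1) by (rule simple_function_comp)
    show "norm (s n (y - x)) \<le> M" for n y by (rule s(2))
    show "(\<lambda>n. s n (y - x)) \<longlonglongrightarrow> f (y - x)" for y by (rule s(3))
  qed
  then show ?thesis
    using LIMSEQ_unique[OF dint_limit[OF cont_sv_translate[OF assms(1), of x] s]]
    by (simp add: simple_int_translate)
qed

lemma norm_dint_split_le:
  fixes \<gamma> :: "('a::euclidean_space, 'v::real_normed_vector, 'w::banach) sv_measure"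
  assumes cont: "cont_sv \<gamma>" and g: "continuous_on UNIV g"
    and M: "\<And>x. norm (g x) \<le> M"
    and U: "U \<in> sets borel" and e: "e > 0" "\<And>x. x \<notin> U \<Longrightarrow> norm (g x) \<le> e"
  shows "norm (dint \<gamma> g) \<le> e * norm \<gamma> + M * svar \<gamma> U"
proof -
  have M0: "0 \<le> M" using order_trans[OF norm_ge_zero M] .
  obtain p :: "nat \<Rightarrow> 'a \<Rightarrow> 'a" where p: "\<And>n. simple_function borel (p n)" "\<And>x. (\<lambda>n. p n x) \<longlonglongrightarrow> x"
    by (rule simple_identity_approximation) auto
  \<comment> \<open>Off \<open>U\<close> the approximations are retracted to the ball of radius \<open>e\<close>.\<close>
  define c where "c v = (e / max e (norm v)) *\<^sub>R v" for v :: 'v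
  have max0: "0 < max e (norm v)" for v :: 'v using e(1) by simp
  have c_le: "norm (c v) \<le> e" "norm (c v) \<le> norm v" for v
  proof -
    have *: "norm (c v) = e * norm v / max e (norm v)"
      using e(1) max0[of v] by (simp add: c_def)
    show "norm (c v) \<le> e" unfolding * using e(1) max0[of v]
      by (simp add: pos_divide_le_eq mult_left_mono)
    have "e * norm v \<le> norm v * max e (norm v)"
      by (subst mult.commute, intro mult_left_mono) auto
    then show "norm (c v) \<le> norm v" unfolding * using max0[of v]
      by (simp add: pos_divide_le_eq)
  qed
  have c_id: "c v = v" if "norm v \<le> e" for v
    using that e(1) by (simp add: c_def max_def)
  have c_cont: "continuous_on UNIV c"
    unfolding c_def using max0 by (intro continuous_intros) (metis less_irrefl)
  define s where "s n x = (if x \<in> U then g (p n x) else c (g (p n x)))" for n x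
  have s_simple: "simple_function borel (s n)" for n
    unfolding s_def using U
    by (intro simple_function_If_set simple_function_compose1[OF p(1)]) auto
  have gp: "(\<lambda>n. g (p n x)) \<longlonglongrightarrow> g x" for x
    using continuous_on_tendsto_compose[OF g p(2)] by simp
  have s_lim: "(\<lambda>n. s n x) \<longlonglongrightarrow> g x" for x
  proof (cases "x \<in> U")
    case True
    then show ?thesis using gp by (simp add: s_def)
  next
    case False
    have "(\<lambda>n. c (g (p n x))) \<longlonglongrightarrow> c (g x)"
      using continuous_on_tendsto_compose[OF c_cont gp] by simp
    then show ?thesis using False e(2) c_id by (simp add: s_def)
  qed
  have s_le: "norm (s n x) \<le> M" for n x
    using M order_trans[OF c_le(2) M] by (simp add: s_def)
  have "norm (simple_int \<gamma> UNIV (s n)) \<le> e * norm \<gamma> + M * svar \<gamma> U" for n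
    using c_le(1) e(1) M0 s_le
    by (intro norm_simple_int_split_le[OF s_simple U]) (auto simp: s_def)
  moreover have "(\<lambda>n. norm (simple_int \<gamma> UNIV (s n))) \<longlonglongrightarrow> norm (dint \<gamma> g)"
    by (rule tendsto_norm[OF dint_limit[OF cont s_simple s_le s_lim]])
  ultimately show ?thesis
    by (intro LIMSEQ_le_const2) auto
qed

lemma norm_dint_le:
  fixes \<gamma> :: "('a::euclidean_space, 'v::real_normed_vector, 'w::banach) sv_measure"
  assumes "cont_sv \<gamma>" "continuous_on UNIV g" "\<And>x. norm (g x) \<le> M"
  shows "norm (dint \<gamma> g) \<le> M * norm \<gamma>"
proof (rule field_le_epsilon)
  fix e :: real assume e: "e > 0"
  have M0: "0 \<le> M" using order_trans[OF norm_ge_zero assms(3)] .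
  have pos: "norm \<gamma> + 1 > 0" by (simp add: add_nonneg_pos)
  define d where "d = e / (norm \<gamma> + 1)"
  have d: "d > 0" using e pos by (simp add: d_def)
  have "norm (dint \<gamma> g) \<le> (M + d) * norm \<gamma> + M * svar \<gamma> {}"
    using assms d M0 by (intro norm_dint_split_le) (auto simp: add_increasing2 less_imp_le)
  moreover have "d * norm \<gamma> \<le> d * (norm \<gamma> + 1)" using d by simp
  moreover have "d * (norm \<gamma> + 1) = e" using pos by (simp add: d_def)
  ultimately show "norm (dint \<gamma> g) \<le> M * norm \<gamma> + e" by (simp add: distrib_right)
qed

text \<open>Bounded convergence for continuous integrands and a continuous limit.\<close>

lemma dint_bounded_convergence:
  fixes \<gamma> :: "('a::euclidean_space, 'v::real_normed_vector, 'w::banach) sv_measure"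
  assumes cont: "cont_sv \<gamma>"
    and g: "\<And>n. continuous_on UNIV (g n)" "continuous_on UNIV g0"
    and M: "\<And>n x. norm (g n x) \<le> M"
    and lim: "\<And>x. (\<lambda>n. g n x) \<longlonglongrightarrow> g0 x"
  shows "(\<lambda>n. dint \<gamma> (g n)) \<longlonglongrightarrow> dint \<gamma> g0"
proof (rule LIMSEQ_I)
  fix e :: real assume e: "e > 0"
  have M0: "norm (g0 x) \<le> M" for x
    using tendsto_norm[OF lim] M by (intro LIMSEQ_le_const2[of "\<lambda>n. norm (g n x)"]) auto
  have Mnn: "0 \<le> M" using order_trans[OF norm_ge_zero M0] .
  define \<epsilon> where "\<epsilon> = e / (2 * (norm \<gamma> + 1))"
  have pos: "norm \<gamma> + 1 > 0" by (simp add: add_nonneg_pos)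
  then have \<epsilon>: "\<epsilon> > 0" using e by (simp add: \<epsilon>_def)
  have "\<epsilon> * norm \<gamma> \<le> \<epsilon> * (norm \<gamma> + 1)" using \<epsilon> by simp
  also have "\<dots> = e / 2" using pos by (simp add: \<epsilon>_def field_simps)
  finally have \<epsilon>2: "\<epsilon> * norm \<gamma> \<le> e / 2" .
  define F where "F m = (\<Union>n\<in>{m..}. {x. \<epsilon> < norm (g n x - g0 x)})" for m
  have "open {x. \<epsilon> < norm (g n x - g0 x)}" for n
    using g by (intro open_Collect_less continuous_intros) auto
  then have F_borel: "F m \<in> sets borel" for m
    unfolding F_def by (intro borel_open open_UN) auto
  have "decseq F"
    unfolding F_def decseq_def by (auto intro: order_trans)
  moreover have "(\<Inter>m. F m) = {}"
  proof (rule ccontr)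
    assume "(\<Inter>m. F m) \<noteq> {}"
    then obtain x where x: "\<And>m. x \<in> F m" by auto
    from LIMSEQ_D[OF lim[of x] \<epsilon>] obtain m where
      "\<And>n. n \<ge> m \<Longrightarrow> norm (g n x - g0 x) < \<epsilon>" by auto
    with x[of m] show False unfolding F_def by fastforce
  qed
  ultimately have "(\<lambda>m. svar \<gamma> (F m)) \<longlonglongrightarrow> 0"
    using F_borel by (intro cont_svD[OF cont]) auto
  then have "(\<lambda>m. 2 * M * svar \<gamma> (F m)) \<longlonglongrightarrow> 0"
    by (rule tendsto_mult_right_zero)
  then have "\<forall>\<^sub>F m in sequentially. 2 * M * svar \<gamma> (F m) < e / 2"
    by (rule order_tendstoD(2)) (use e in simp)
  then obtain m where m: "2 * M * svar \<gamma> (F m) < e / 2"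
    using eventually_happens'[OF sequentially_bot] by auto
  have bc: "bounded_continuous (g n)" "bounded_continuous g0" for n
    using g M M0 unfolding bounded_continuous_def by auto
  have "norm (dint \<gamma> (g n) - dint \<gamma> g0) < e" if n: "n \<ge> m" for n
  proof -
    have "dint \<gamma> (g n) - dint \<gamma> g0 = dint \<gamma> (\<lambda>x. g n x - g0 x)"
      by (rule dint_diff[OF cont bc, symmetric])
    also have "norm \<dots> \<le> \<epsilon> * norm \<gamma> + 2 * M * svar \<gamma> (F m)"
    proof (rule norm_dint_split_le[OF cont _ _ F_borel \<epsilon>])
      show "continuous_on UNIV (\<lambda>x. g n x - g0 x)" using g by (intro continuous_intros)
      show "norm (g n x - g0 x) \<le> \<epsilon>" if "x \<notin> F m" for x
        using that n unfolding F_def by fastforce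
      show "norm (g n x - g0 x) \<le> 2 * M" for x
        using norm_triangle_ineq4[of "g n x" "g0 x"] M[of n x] M0[of x] by linarith
    qed
    also have "\<dots> < e / 2 + e / 2" using \<epsilon>2 m by (rule add_le_less_mono)
    finally show ?thesis by simp
  qed
  then show "\<exists>m. \<forall>n\<ge>m. norm (dint \<gamma> (g n) - dint \<gamma> g0) < e" by blast
qed

section \<open>Iterated directional derivatives\<close>

text \<open>For a list \<open>xs\<close>, the derivative along the last vector is taken first.\<close>

abbreviation iter_deriv ::
  "'a::real_normed_vector list \<Rightarrow> ('a \<Rightarrow> 'e::real_normed_vector) \<Rightarrow> 'a \<Rightarrow> 'e" where
  "iter_deriv \<equiv> foldr dir_deriv"

text \<open>
  The function \<open>g\<close> is the derivative of \<open>f\<close> along \<open>h\<close> at every point. In contrast to \<open>dir_deriv\<close>, this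
  includes existence of the derivative.
\<close>

definition has_dir_deriv ::
  "('a::real_normed_vector \<Rightarrow> 'e::real_normed_vector) \<Rightarrow> 'a \<Rightarrow> ('a \<Rightarrow> 'e) \<Rightarrow> bool" where
  "has_dir_deriv f h g \<longleftrightarrow> (\<forall>x. ((\<lambda>t. f (x + t *\<^sub>R h)) has_vector_derivative g x) (at 0))"

lemma has_dir_deriv_imp_eq: "has_dir_deriv f h g \<Longrightarrow> dir_deriv h f = g"
  unfolding has_dir_deriv_def dir_deriv_def by (auto simp: vector_derivative_at)

lemma has_dir_deriv_line:
  assumes "has_dir_deriv f h g"
  shows "((\<lambda>t. f (x + t *\<^sub>R h)) has_vector_derivative g (x + s *\<^sub>R h)) (at s within S)"
proof -
  have "((\<lambda>t. f ((x + s *\<^sub>R h) + t *\<^sub>R h)) has_vector_derivative g (x + s *\<^sub>R h)) (at (s - s))"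
    using assms unfolding has_dir_deriv_def by simp
  then have "((\<lambda>t. f ((x + s *\<^sub>R h) + t *\<^sub>R h)) \<circ> (\<lambda>t. t - s) has_vector_derivative 1 *\<^sub>R g (x + s *\<^sub>R h)) (at s)"
    by (intro vector_diff_chain_at) (auto intro!: derivative_eq_intros)
  then have "((\<lambda>t. f (x + t *\<^sub>R h)) has_vector_derivative g (x + s *\<^sub>R h)) (at s)"
    by (simp add: o_def algebra_simps)
  then show ?thesis by (rule has_vector_derivative_at_within)
qed

text \<open>Mean value inequality, with the linear part \<open>c\<close> split off.\<close>

lemma mean_value_bound:
  fixes \<phi> :: "real \<Rightarrow> 'e::real_normed_vector"
  assumes t: "0 \<le> t"
    and der: "\<And>s. (\<phi> has_vector_derivative \<phi>' s) (at s)"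
    and B: "\<And>s. 0 \<le> s \<Longrightarrow> s \<le> t \<Longrightarrow> norm (\<phi>' s - c) \<le> B"
  shows "norm (\<phi> t - \<phi> 0 - t *\<^sub>R c) \<le> B * t"
proof -
  have B0: "0 \<le> B" using B[of 0] t order_trans[OF norm_ge_zero] by blast
  have "norm ((\<phi> t - t *\<^sub>R c) - (\<phi> 0 - 0 *\<^sub>R c)) \<le> B * norm (t - 0)"
  proof (rule differentiable_bound[where S = "{0..t}" and f' = "\<lambda>s r. r *\<^sub>R (\<phi>' s - c)"])
    fix s assume s: "s \<in> {0..t}"
    have "((\<lambda>s. \<phi> s - s *\<^sub>R c) has_vector_derivative \<phi>' s - 1 *\<^sub>R c) (at s within {0..t})"
      by (intro has_vector_derivative_diff has_vector_derivative_at_within[OF der]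
          has_vector_derivative_scaleR[of _ 1 _ _ "\<lambda>_. c" 0, simplified]) (auto intro!: derivative_eq_intros)
    then show "((\<lambda>s. \<phi> s - s *\<^sub>R c) has_derivative (\<lambda>r. r *\<^sub>R (\<phi>' s - c))) (at s within {0..t})"
      by (simp add: has_vector_derivative_def)
    show "onorm (\<lambda>r. r *\<^sub>R (\<phi>' s - c)) \<le> B"
      using B[of s] s B0 by (intro onorm_bound) (auto simp: mult.commute[of B] intro: mult_left_mono)
  qed (use t in auto)
  then show ?thesis using t by (simp add: algebra_simps)
qed

lemma has_dir_deriv_bound:
  assumes "has_dir_deriv f h g" "0 \<le> t" "\<And>s. 0 \<le> s \<Longrightarrow> s \<le> t \<Longrightarrow> norm (g (x + s *\<^sub>R h) - c) \<le> B"
  shows "norm (f (x + t *\<^sub>R h) - f x - t *\<^sub>R c) \<le> B * t"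
  using mean_value_bound[of t "\<lambda>t. f (x + t *\<^sub>R h)" "\<lambda>s. g (x + s *\<^sub>R h)" c B]
    has_dir_deriv_line[OF assms(1)] assms(2,3) by simp

text \<open>Second differences along \<open>u\<close> and \<open>v\<close> are governed by the mixed derivative.\<close>

lemma second_difference_bound:
  fixes f :: "'a::real_normed_vector \<Rightarrow> 'e::real_normed_vector"
  assumes fu: "has_dir_deriv f u fu" and fuv: "has_dir_deriv fu v fuv"
    and t: "0 \<le> t"
    and B: "\<And>r s. 0 \<le> r \<Longrightarrow> r \<le> t \<Longrightarrow> 0 \<le> s \<Longrightarrow> s \<le> t \<Longrightarrow> norm (fuv (x + r *\<^sub>R u + s *\<^sub>R v) - c) \<le> B"
  shows "norm ((f (x + t *\<^sub>R u + t *\<^sub>R v) - f (x + t *\<^sub>R u)) - (f (x + t *\<^sub>R v) - f x) - t *\<^sub>R t *\<^sub>R c)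
    \<le> B * t * t"
proof -
  let ?\<phi> = "\<lambda>r. f ((x + t *\<^sub>R v) + r *\<^sub>R u) - f (x + r *\<^sub>R u)"
  let ?\<phi>' = "\<lambda>r. fu ((x + t *\<^sub>R v) + r *\<^sub>R u) - fu (x + r *\<^sub>R u)"
  have "norm (?\<phi> t - ?\<phi> 0 - t *\<^sub>R (t *\<^sub>R c)) \<le> (B * t) * t"
  proof (rule mean_value_bound[OF t, where \<phi>' = ?\<phi>'])
    show "(?\<phi> has_vector_derivative ?\<phi>' s) (at s)" for s
      by (intro has_vector_derivative_diff has_dir_deriv_line[OF fu])
    fix r assume r: "0 \<le> r" "r \<le> t"
    show "norm (?\<phi>' r - t *\<^sub>R c) \<le> B * t"
      using has_dir_deriv_bound[OF fuv t, of "x + r *\<^sub>R u" c B] B[OF r]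
      by (simp add: add_ac)
  qed
  then show ?thesis by (simp add: add_ac mult_ac)
qed

lemma mixed_derivatives_commute:
  fixes f :: "'a::real_normed_vector \<Rightarrow> 'e::real_normed_vector"
  assumes fu: "has_dir_deriv f u fu" and fuv: "has_dir_deriv fu v fuv"
    and fv: "has_dir_deriv f v fv" and fvu: "has_dir_deriv fv u fvu"
    and cont: "continuous_on UNIV fuv" "continuous_on UNIV fvu"
  shows "fuv = fvu"
proof
  fix x
  show "fuv x = fvu x"
  proof (rule ccontr)
    assume neq: "fuv x \<noteq> fvu x"
    \<comment> \<open>Multiplied by \<open>t\<^sup>2\<close>, both values approximate the same second difference up to \<open>e * t\<^sup>2\<close>,
        although they are \<open>3 * e * t\<^sup>2\<close> apart.\<close>
    define e where "e = norm (fuv x - fvu x) / 3"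
    have e: "e > 0" using neq by (simp add: e_def)
    have near: "\<exists>d>0. \<forall>y. dist y x < d \<longrightarrow> norm (w y - w x) \<le> e" if "continuous_on UNIV w" for w :: "'a \<Rightarrow> 'e"
      using that e unfolding continuous_on_iff dist_norm by (metis UNIV_I less_imp_le)
    obtain d1 where d1: "d1 > 0" "\<And>y. dist y x < d1 \<Longrightarrow> norm (fuv y - fuv x) \<le> e"
      using near[OF cont(1)] by auto
    obtain d2 where d2: "d2 > 0" "\<And>y. dist y x < d2 \<Longrightarrow> norm (fvu y - fvu x) \<le> e"
      using near[OF cont(2)] by auto
    define k where "k = norm u + norm v + 1"
    have k: "k > 0" by (simp add: k_def add_nonneg_pos)
    define t where "t = min d1 d2 / (2 * k)"
    have t: "t > 0" "t * k < d1" "t * k < d2"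
      using d1(1) d2(1) k by (auto simp: t_def)
    have dist: "dist (x + r *\<^sub>R u + s *\<^sub>R v) x \<le> t * k"
      if "0 \<le> r" "r \<le> t" "0 \<le> s" "s \<le> t" for r s
    proof -
      have "dist (x + r *\<^sub>R u + s *\<^sub>R v) x = norm (r *\<^sub>R u + s *\<^sub>R v)"
        by (simp add: dist_norm)
      also have "\<dots> \<le> t * norm u + t * norm v"
        using that by (intro norm_triangle_mono) (auto intro: mult_right_mono)
      also have "\<dots> \<le> t * k" using t(1) by (simp add: k_def distrib_left)
      finally show ?thesis .
    qed
    let ?\<Delta> = "(f (x + t *\<^sub>R u + t *\<^sub>R v) - f (x + t *\<^sub>R u)) - (f (x + t *\<^sub>R v) - f x)"
    have 1: "norm (?\<Delta> - t *\<^sub>R t *\<^sub>R fuv x) \<le> e * t * t"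
      using dist t d1(2) by (intro second_difference_bound[OF fu fuv]) (auto intro: le_less_trans)
    have "norm ((f (x + t *\<^sub>R v + t *\<^sub>R u) - f (x + t *\<^sub>R v)) - (f (x + t *\<^sub>R u) - f x) - t *\<^sub>R t *\<^sub>R fvu x) \<le> e * t * t"
    proof (rule second_difference_bound[OF fv fvu])
      fix r s assume "0 \<le> r" "r \<le> t" "0 \<le> s" "s \<le> t"
      then have "dist (x + s *\<^sub>R u + r *\<^sub>R v) x \<le> t * k" by (intro dist)
      then show "norm (fvu (x + r *\<^sub>R v + s *\<^sub>R u) - fvu x) \<le> e"
        using t(3) by (intro d2(2)) (simp add: add_ac)
    qed (use t in simp)
    then have 2: "norm (?\<Delta> - t *\<^sub>R t *\<^sub>R fvu x) \<le> e * t * t"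
      by (simp add: algebra_simps)
    have "t *\<^sub>R t *\<^sub>R (fuv x - fvu x) = (?\<Delta> - t *\<^sub>R t *\<^sub>R fvu x) - (?\<Delta> - t *\<^sub>R t *\<^sub>R fuv x)"
      by (simp add: scaleR_diff_right)
    then have "norm (t *\<^sub>R t *\<^sub>R (fuv x - fvu x)) \<le> e * t * t + e * t * t"
      using norm_triangle_ineq4[of "?\<Delta> - t *\<^sub>R t *\<^sub>R fvu x" "?\<Delta> - t *\<^sub>R t *\<^sub>R fuv x"] 1 2 by simp
    then have "t * t * (3 * e) \<le> t * t * (2 * e)"
      by (simp add: e_def mult_ac)
    then show False using t(1) e by (simp add: mult_le_cancel_left_pos)
  qed
qed

text \<open>
  All directional derivatives up to order \<open>k\<close>, in any order of differentiation, exist and are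
  continuous. This weakening of \<open>k\<close>-fold Fr\'echet differentiability carries the rest of the proof.
\<close>

definition iter_smooth ::
  "nat \<Rightarrow> ('a::real_normed_vector \<Rightarrow> 'e::real_normed_vector) \<Rightarrow> bool" where
  "iter_smooth k f \<longleftrightarrow>
     (\<forall>xs. length xs \<le> k \<longrightarrow> continuous_on UNIV (iter_deriv xs f)) \<and>
     (\<forall>h xs. length xs < k \<longrightarrow> has_dir_deriv (iter_deriv xs f) h (iter_deriv (h # xs) f))"

text \<open>
  With the remaining arguments fixed, the operator-norm estimates become ordinary Fr\'echet
  derivatives. In the proofs, the error is divided by \<open>?P + 1\<close>, since \<open>?P\<close> may be \<open>0\<close>.
\<close>

lemma frechet_step:
  assumes D: "iterated_frechet k f D" and j: "length hs < k"
  shows "((\<lambda>y. D (length hs) y hs) has_derivative (\<lambda>h. D (Suc (length hs)) x (h # hs))) (at x)"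
proof -
  let ?j = "length hs" and ?P = "prod_list (map norm hs)"
  have P0: "?P \<ge> 0" by (induction hs) auto
  have ml: "bounded_multilinear (Suc ?j) (D (Suc ?j) x)"
    using D j unfolding iterated_frechet_def by simp
  then have "linear (\<lambda>h. D (Suc ?j) x ([] @ h # hs))"
    unfolding bounded_multilinear_def by (metis add_0 list.size(3) Suc_eq_plus1)
  then have lin: "linear (\<lambda>h. D (Suc ?j) x (h # hs))" by simp
  obtain M where M: "\<And>hs'. length hs' = Suc ?j \<Longrightarrow> norm (D (Suc ?j) x hs') \<le> M * prod_list (map norm hs')"
    using ml unfolding bounded_multilinear_def by auto
  have "bounded_linear (\<lambda>h. D (Suc ?j) x (h # hs))"
    using linear_add[OF lin] linear_scale[OF lin] M[of "_ # hs"]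
    by (intro bounded_linear_intro[where K = "M * ?P"]) (auto simp: mult_ac)
  moreover have "\<exists>d>0. \<forall>y. norm (y - x) < d \<longrightarrow>
      norm (D ?j y hs - D ?j x hs - D (Suc ?j) x ((y - x) # hs)) \<le> e * norm (y - x)"
    if e: "e > 0" for e
  proof -
    have e': "e / (?P + 1) > 0" using e P0 by (simp add: add_nonneg_pos)
    have "\<forall>\<^sub>F y in nhds x. \<forall>hs'. length hs' = ?j \<longrightarrow>
        norm (D ?j y hs' - D ?j x hs' - D (Suc ?j) x ((y - x) # hs'))
          \<le> e / (?P + 1) * norm (y - x) * prod_list (map norm hs')"
      using D j e' unfolding iterated_frechet_def by blast
    then obtain d where d: "d > 0" "\<And>y. dist y x < d \<Longrightarrow>
        norm (D ?j y hs - D ?j x hs - D (Suc ?j) x ((y - x) # hs)) \<le> e / (?P + 1) * norm (y - x) * ?P"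
      unfolding eventually_nhds_metric by auto
    have "e / (?P + 1) * norm (y - x) * ?P \<le> e * norm (y - x)" for y
    proof -
      have "?P / (?P + 1) \<le> 1" using P0 by simp
      then have "(e * norm (y - x)) * (?P / (?P + 1)) \<le> (e * norm (y - x)) * 1"
        using e by (intro mult_left_mono) auto
      then show ?thesis by (simp add: mult_ac)
    qed
    then show ?thesis using d by (intro exI[of _ d]) (auto simp: dist_norm intro: order_trans)
  qed
  ultimately show ?thesis
    unfolding has_derivative_at_alt by blast
qed

lemma frechet_top_continuous:
  assumes D: "iterated_frechet k f D" and j: "length hs = k"
  shows "continuous_on UNIV (\<lambda>y. D k y hs)"
  unfolding continuous_on_iff
proof (intro ballI allI impI)
  fix x and e :: real assume e: "e > 0"
  let ?P = "prod_list (map norm hs)"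
  have P0: "?P \<ge> 0" by (induction hs) auto
  have e': "e / (?P + 1) > 0" using e P0 by (simp add: add_nonneg_pos)
  have "\<forall>\<^sub>F y in nhds x. \<forall>hs'. length hs' = k \<longrightarrow>
      norm (D k y hs' - D k x hs') \<le> e / (?P + 1) * prod_list (map norm hs')"
    using D e' unfolding iterated_frechet_def by blast
  then obtain d where d: "d > 0" "\<And>y. dist y x < d \<Longrightarrow> norm (D k y hs - D k x hs) \<le> e / (?P + 1) * ?P"
    unfolding eventually_nhds_metric using j by auto
  have "e / (?P + 1) * ?P < e"
    using e P0 by (simp add: pos_divide_less_eq add_nonneg_pos)
  then show "\<exists>d>0. \<forall>y\<in>UNIV. dist y x < d \<longrightarrow> dist (D k y hs) (D k x hs) < e"
    using d by (intro exI[of _ d]) (auto simp: dist_norm intro: le_less_trans)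
qed

lemma frechet_has_dir_deriv:
  assumes "iterated_frechet k f D" "length hs < k"
  shows "has_dir_deriv (\<lambda>y. D (length hs) y hs) h (\<lambda>x. D (Suc (length hs)) x (h # hs))"
  unfolding has_dir_deriv_def
proof
  fix x
  let ?F = "\<lambda>y. D (length hs) y hs" and ?G = "\<lambda>h. D (Suc (length hs)) x (h # hs)"
  have der: "(?F has_derivative ?G) (at (x + 0 *\<^sub>R h))"
    using frechet_step[OF assms, of x] by simp
  have "((\<lambda>t. x + t *\<^sub>R h) has_derivative (\<lambda>t. t *\<^sub>R h)) (at 0)"
    by (auto intro!: derivative_eq_intros)
  from has_derivative_compose[OF this der]
  have "((\<lambda>t. ?F (x + t *\<^sub>R h)) has_derivative (\<lambda>t. ?G (t *\<^sub>R h))) (at 0)" .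
  moreover have "?G (t *\<^sub>R h) = t *\<^sub>R ?G h" for t
    using linear_scale[OF bounded_linear.linear[OF has_derivative_bounded_linear[OF der]]] by simp
  ultimately show "((\<lambda>t. ?F (x + t *\<^sub>R h)) has_vector_derivative ?G h) (at 0)"
    unfolding has_vector_derivative_def by simp
qed

lemma iter_deriv_eq_frechet:
  assumes D: "iterated_frechet k f D" and "length xs \<le> k"
  shows "iter_deriv xs f = (\<lambda>x. D (length xs) x xs)"
  using assms(2)
proof (induction xs)
  case Nil
  then show ?case using D unfolding iterated_frechet_def by auto
next
  case (Cons h xs)
  then have "iter_deriv (h # xs) f = dir_deriv h (\<lambda>x. D (length xs) x xs)" by simp
  also have "\<dots> = (\<lambda>x. D (Suc (length xs)) x (h # xs))"
    using Cons.prems by (intro has_dir_deriv_imp_eq frechet_has_dir_deriv[OF D]) simp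
  finally show ?case by simp
qed

lemma iter_smooth_if_frechet:
  assumes D: "iterated_frechet k f D"
  shows "iter_smooth k f"
  unfolding iter_smooth_def
proof (intro conjI allI impI)
  fix xs :: "'a list" assume xs: "length xs \<le> k"
  show "continuous_on UNIV (iter_deriv xs f)"
  proof (cases "length xs = k")
    case True
    then show ?thesis
      using frechet_top_continuous[OF D True] iter_deriv_eq_frechet[OF D xs] by simp
  next
    case False
    with xs have "length xs < k" by simp
    then have "continuous_on UNIV (\<lambda>x. D (length xs) x xs)"
      using has_derivative_continuous[OF frechet_step[OF D]]
      by (intro continuous_at_imp_continuous_on) auto
    then show ?thesis using iter_deriv_eq_frechet[OF D xs] by simp
  qed
next
  fix h and xs :: "'a list" assume xs: "length xs < k"
  then show "has_dir_deriv (iter_deriv xs f) h (iter_deriv (h # xs) f)"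
    using frechet_has_dir_deriv[OF D xs, of h] iter_deriv_eq_frechet[OF D, of xs]
      iter_deriv_eq_frechet[OF D, of "h # xs"] by simp
qed

lemma iter_deriv_swap:
  assumes f: "iter_smooth k f" and "length xs + 2 \<le> k"
  shows "iter_deriv (u # v # xs) f = iter_deriv (v # u # xs) f"
proof (rule mixed_derivatives_commute)
  show "has_dir_deriv (iter_deriv xs f) v (iter_deriv (v # xs) f)"
    "has_dir_deriv (iter_deriv (v # xs) f) u (iter_deriv (u # v # xs) f)"
    "has_dir_deriv (iter_deriv xs f) u (iter_deriv (u # xs) f)"
    "has_dir_deriv (iter_deriv (u # xs) f) v (iter_deriv (v # u # xs) f)"
    "continuous_on UNIV (iter_deriv (u # v # xs) f)"
    "continuous_on UNIV (iter_deriv (v # u # xs) f)"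
    using f assms(2) unfolding iter_smooth_def by (auto simp del: foldr.simps)
qed

lemma iter_deriv_move_front:
  assumes f: "iter_smooth k f" and "length (xs @ u # ys) \<le> k"
  shows "iter_deriv (xs @ u # ys) f = iter_deriv (u # xs @ ys) f"
  using assms(2)
proof (induction xs)
  case (Cons x xs)
  then have "iter_deriv ((x # xs) @ u # ys) f = iter_deriv (x # u # xs @ ys) f" by simp
  also have "\<dots> = iter_deriv (u # x # xs @ ys) f"
    using Cons.prems by (intro iter_deriv_swap[OF f]) simp
  finally show ?case by simp
qed simp

text \<open>Adjacent swaps generate all rearrangements.\<close>

lemma iter_deriv_mset_eq:
  assumes f: "iter_smooth k f"
  shows "mset xs = mset ys \<Longrightarrow> length xs \<le> k \<Longrightarrow> iter_deriv xs f = iter_deriv ys f"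
proof (induction xs arbitrary: ys)
  case Nil
  then show ?case by simp
next
  case (Cons x xs)
  then have "x \<in> set ys" by (metis list.set_intros(1) set_mset_mset)
  then obtain as bs where ys: "ys = as @ x # bs" by (auto dest: split_list)
  have eq: "mset xs = mset (as @ bs)" using Cons.prems(1) by (simp add: ys)
  have len: "length ys \<le> k" using Cons.prems mset_eq_length by metis
  have "iter_deriv (x # xs) f = iter_deriv (x # as @ bs) f"
    using Cons.IH[OF eq] Cons.prems(2) by simp
  also have "\<dots> = iter_deriv ys f"
    unfolding ys using len by (intro iter_deriv_move_front[OF f, symmetric]) (simp add: ys)
  finally show ?case .
qed

text \<open>
  The mixed derivative uses an unspecified enumeration of the multiset; by symmetry it may be
  replaced by any other one.
\<close>

lemma mixed_eq_foldr: "\<exists>xs. mset xs = h \<and> mixed d h = foldr d xs"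
  unfolding mixed_def using someI_ex[OF ex_mset[of h]] by blast

lemma mixed_empty [simp]: "mixed d {#} f = f"
  using mixed_eq_foldr[of "{#}" d] by auto

lemma mixed_dir_deriv_eq:
  assumes "iter_smooth k f" "size h \<le> k" "mset xs = h"
  shows "mixed dir_deriv h f = iter_deriv xs f"
proof -
  obtain ys where ys: "mset ys = h" "mixed dir_deriv h f = iter_deriv ys f"
    using mixed_eq_foldr[of h dir_deriv] by metis
  then have "length ys \<le> k" using assms(2) size_mset by metis
  with ys assms(3) show ?thesis using iter_deriv_mset_eq[OF assms(1), of ys xs] by simp
qed

lemma mixed_dir_deriv_add:
  assumes f: "iter_smooth k f" and h: "size h < k"
  shows "has_dir_deriv (mixed dir_deriv h f) v (mixed dir_deriv (add_mset v h) f)"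
proof -
  obtain xs where xs: "mset xs = h" using ex_mset by blast
  then have len: "length xs < k" using h size_mset by metis
  have "mixed dir_deriv h f = iter_deriv xs f"
    using h xs by (intro mixed_dir_deriv_eq[OF f]) auto
  moreover have "mixed dir_deriv (add_mset v h) f = iter_deriv (v # xs) f"
    using h xs by (intro mixed_dir_deriv_eq[OF f]) auto
  ultimately show ?thesis using f len unfolding iter_smooth_def by simp
qed

lemma bounded_continuous_mixed:
  assumes f: "C_B_k k f" and h: "size h \<le> k"
  shows "bounded_continuous (mixed dir_deriv h f)"
proof -
  obtain D where D: "iterated_frechet k f D"
    and bd: "\<And>j. j \<le> k \<Longrightarrow> \<exists>M. \<forall>x hs. length hs = j \<longrightarrow> norm (D j x hs) \<le> M * prod_list (map norm hs)"
    using f unfolding C_B_k_def by blast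
  obtain xs where xs: "mset xs = h" using ex_mset by blast
  then have len: "length xs \<le> k" using h size_mset by metis
  have smooth: "iter_smooth k f" by (rule iter_smooth_if_frechet[OF D])
  have eq: "mixed dir_deriv h f = iter_deriv xs f"
    by (rule mixed_dir_deriv_eq[OF smooth h xs])
  obtain M where "\<And>x hs. length hs = length xs \<Longrightarrow> norm (D (length xs) x hs) \<le> M * prod_list (map norm hs)"
    using bd[OF len] by blast
  then have "\<forall>x. norm (iter_deriv xs f x) \<le> M * prod_list (map norm xs)"
    unfolding iter_deriv_eq_frechet[OF D len] by simp
  moreover have "continuous_on UNIV (iter_deriv xs f)"
    using smooth len unfolding iter_smooth_def by simp
  ultimately show ?thesis unfolding bounded_continuous_def eq by blast
qed

lemma iter_smooth_C_B_k: "C_B_k k f \<Longrightarrow> iter_smooth k f"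
  unfolding C_B_k_def using iter_smooth_if_frechet by blast

section \<open>Iterated Fomin derivatives\<close>

text \<open>
  The Fomin derivative of \<open>\<gamma>\<close> along \<open>h\<close> exists and equals \<open>\<delta>\<close>, the limit being taken in the
  semivariation norm.
\<close>

definition has_fomin_deriv ::
  "('a::euclidean_space, 'v::real_normed_vector, 'w::real_normed_vector) sv_measure \<Rightarrow> 'a \<Rightarrow>
   ('a, 'v, 'w) sv_measure \<Rightarrow> bool" where
  "has_fomin_deriv \<gamma> h \<delta> \<longleftrightarrow> ((\<lambda>t. (translate (t *\<^sub>R h) \<gamma> - \<gamma>) /\<^sub>R t) \<longlongrightarrow> \<delta>) (at 0)"

lemma has_fomin_deriv_imp_eq: "has_fomin_deriv \<gamma> h \<delta> \<Longrightarrow> fomin_deriv h \<gamma> = \<delta>"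
  unfolding has_fomin_deriv_def fomin_deriv_def by (intro tendsto_Lim) auto

lemma cont_sv_has_fomin_deriv:
  assumes "cont_sv \<gamma>" "has_fomin_deriv \<gamma> h \<delta>"
  shows "cont_sv \<delta>"
  using assms(2) unfolding has_fomin_deriv_def
  by (rule cont_sv_limit)
     (auto intro!: always_eventually cont_sv_scaleR cont_sv_diff cont_sv_translate assms(1))

lemma has_fomin_derivI:
  assumes "((\<lambda>t. translate (t *\<^sub>R h) \<gamma>) has_vector_derivative \<delta>) (at 0)"
  shows "has_fomin_deriv \<gamma> h \<delta>"
proof -
  have "((\<lambda>t. norm (translate (t *\<^sub>R h) \<gamma> - \<gamma> - t *\<^sub>R \<delta>) / norm t) \<longlongrightarrow> 0) (at 0)"
    using assms unfolding has_vector_derivative_def has_derivative_at by simp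
  moreover have "\<forall>\<^sub>F t in at 0. norm (translate (t *\<^sub>R h) \<gamma> - \<gamma> - t *\<^sub>R \<delta>) / norm t
      = norm ((translate (t *\<^sub>R h) \<gamma> - \<gamma>) /\<^sub>R t - \<delta>)"
  proof -
    have *: "norm (u - t *\<^sub>R \<delta>) / norm t = norm (u /\<^sub>R t - \<delta>)" if "t \<noteq> 0" for t u
    proof -
      have "u - t *\<^sub>R \<delta> = t *\<^sub>R (u /\<^sub>R t - \<delta>)" using that by (simp add: scaleR_diff_right)
      then show ?thesis using that by simp
    qed
    show ?thesis unfolding eventually_at_filter by (intro always_eventually allI impI *)
  qed
  ultimately have "((\<lambda>t. norm ((translate (t *\<^sub>R h) \<gamma> - \<gamma>) /\<^sub>R t - \<delta>)) \<longlongrightarrow> 0) (at 0)"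
    by (rule Lim_transform_eventually)
  then show ?thesis
    unfolding has_fomin_deriv_def by (rule LIM_zero_cancel[OF tendsto_norm_zero_cancel])
qed

text \<open>Differentiating \<open>x \<mapsto> \<mu>\<^sub>x\<close> along directions amounts to translating Fomin derivatives.\<close>

lemma has_fomin_deriv_if_has_dir_deriv:
  assumes "has_dir_deriv (\<lambda>x. translate x \<gamma>) h g"
  shows "has_fomin_deriv \<gamma> h (fomin_deriv h \<gamma>)"
    and "g = (\<lambda>x. translate x (fomin_deriv h \<gamma>))"
proof -
  have der: "((\<lambda>t. translate (t *\<^sub>R h) \<gamma>) has_vector_derivative g 0) (at 0)"
    using assms[unfolded has_dir_deriv_def, rule_format, of 0] by simp
  then have "has_fomin_deriv \<gamma> h (g 0)" by (rule has_fomin_derivI)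
  moreover from has_fomin_deriv_imp_eq[OF this] have eq: "fomin_deriv h \<gamma> = g 0" .
  ultimately show "has_fomin_deriv \<gamma> h (fomin_deriv h \<gamma>)" by simp
  have "has_dir_deriv (\<lambda>x. translate x \<gamma>) h (\<lambda>x. translate x (g 0))"
    unfolding has_dir_deriv_def
  proof
    fix x
    show "((\<lambda>t. translate (x + t *\<^sub>R h) \<gamma>) has_vector_derivative translate x (g 0)) (at 0)"
      using bounded_linear.has_vector_derivative[OF bounded_linear_translate der, of x]
      by (simp add: translate_translate)
  qed
  from has_dir_deriv_imp_eq[OF this] has_dir_deriv_imp_eq[OF assms]
  show "g = (\<lambda>x. translate x (fomin_deriv h \<gamma>))" by (simp add: eq)
qed

lemma iter_deriv_translate:
  assumes smooth: "iter_smooth k (\<lambda>x. translate x \<mu>)"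
  shows "length xs \<le> k \<Longrightarrow>
    iter_deriv xs (\<lambda>x. translate x \<mu>) = (\<lambda>x. translate x (foldr fomin_deriv xs \<mu>))"
proof (induction xs)
  case (Cons h xs)
  have "has_dir_deriv (iter_deriv xs (\<lambda>x. translate x \<mu>)) h (iter_deriv (h # xs) (\<lambda>x. translate x \<mu>))"
    using smooth Cons.prems unfolding iter_smooth_def by (simp del: foldr.simps)
  with Cons have "has_dir_deriv (\<lambda>x. translate x (foldr fomin_deriv xs \<mu>)) h (iter_deriv (h # xs) (\<lambda>x. translate x \<mu>))"
    by (simp del: foldr.simps)
  from has_fomin_deriv_if_has_dir_deriv(2)[OF this] show ?case by simp
qed simp

lemma foldr_fomin_eq_iter_deriv:
  assumes "iter_smooth k (\<lambda>x. translate x \<mu>)" "length xs \<le> k"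
  shows "foldr fomin_deriv xs \<mu> = iter_deriv xs (\<lambda>x. translate x \<mu>) 0"
  by (simp add: iter_deriv_translate[OF assms])

lemma mixed_fomin_deriv_eq:
  assumes smooth: "iter_smooth k (\<lambda>x. translate x \<mu>)" and "size \<alpha> \<le> k" "mset xs = \<alpha>"
  shows "mixed fomin_deriv \<alpha> \<mu> = foldr fomin_deriv xs \<mu>"
proof -
  obtain ys where ys: "mset ys = \<alpha>" "mixed fomin_deriv \<alpha> \<mu> = foldr fomin_deriv ys \<mu>"
    using mixed_eq_foldr[of \<alpha> fomin_deriv] by metis
  have "length ys \<le> k" using assms(2) unfolding ys(1)[symmetric] by simp
  moreover have "length xs \<le> k" using assms(2) unfolding assms(3)[symmetric] by simp
  ultimately show ?thesis
    using ys iter_deriv_mset_eq[OF smooth, of ys xs] assms(3)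
    by (simp add: foldr_fomin_eq_iter_deriv[OF smooth])
qed

lemma mixed_fomin_deriv_add:
  assumes smooth: "iter_smooth k (\<lambda>x. translate x \<mu>)" and \<alpha>: "size \<alpha> < k"
  shows "has_fomin_deriv (mixed fomin_deriv \<alpha> \<mu>) v (mixed fomin_deriv (add_mset v \<alpha>) \<mu>)"
proof -
  obtain xs where xs: "mset xs = \<alpha>" using ex_mset by blast
  then have len: "length xs < k" using \<alpha> by auto
  have 1: "mixed fomin_deriv \<alpha> \<mu> = foldr fomin_deriv xs \<mu>"
    using \<alpha> xs by (intro mixed_fomin_deriv_eq[OF smooth]) auto
  have 2: "mixed fomin_deriv (add_mset v \<alpha>) \<mu> = foldr fomin_deriv (v # xs) \<mu>"
    using \<alpha> xs by (intro mixed_fomin_deriv_eq[OF smooth]) auto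
  have "has_dir_deriv (iter_deriv xs (\<lambda>x. translate x \<mu>)) v (iter_deriv (v # xs) (\<lambda>x. translate x \<mu>))"
    using smooth len unfolding iter_smooth_def by (simp del: foldr.simps)
  then have "has_dir_deriv (\<lambda>x. translate x (foldr fomin_deriv xs \<mu>)) v (iter_deriv (v # xs) (\<lambda>x. translate x \<mu>))"
    using iter_deriv_translate[OF smooth, of xs] len by (simp del: foldr.simps)
  from has_fomin_deriv_if_has_dir_deriv(1)[OF this] show ?thesis by (simp add: 1 2)
qed

lemma cont_sv_mixed_fomin_deriv:
  assumes smooth: "iter_smooth k (\<lambda>x. translate x \<mu>)" and "cont_sv \<mu>"
  shows "size \<alpha> \<le> k \<Longrightarrow> cont_sv (mixed fomin_deriv \<alpha> \<mu>)"
proof (induction \<alpha>)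
  case (add v \<alpha>)
  then show ?case
    by (intro cont_sv_has_fomin_deriv[OF _ mixed_fomin_deriv_add[OF smooth]]) auto
qed (simp add: assms(2))

section \<open>Integration by parts along one direction\<close>

lemma has_dir_deriv_norm_diff_le:
  assumes "has_dir_deriv g v g'" "\<And>x. norm (g' x) \<le> L" "0 \<le> t"
  shows "norm (g (x + t *\<^sub>R v) - g x) \<le> L * t"
  using has_dir_deriv_bound[OF assms(1,3), of x 0 L] assms(2) by simp

text \<open>
  Both sides are limits of the integral of \<open>g\<close> with respect to the difference quotients
  \<open>q n = (\<gamma>\<^sub>t\<^sub>v - \<gamma>) / t\<close> for \<open>t = 1 / (n + 1)\<close>.
\<close>

lemma dint_fomin_deriv:
  fixes \<gamma> :: "('a::euclidean_space, 'v::real_normed_vector, 'w::banach) sv_measure"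
  assumes \<gamma>: "cont_sv \<gamma>" and \<delta>: "has_fomin_deriv \<gamma> v \<delta>"
    and g: "bounded_continuous g" and g': "has_dir_deriv g v g'" "bounded_continuous g'"
  shows "dint \<delta> g = - dint \<gamma> g'"
proof -
  have cont_\<delta>: "cont_sv \<delta>" by (rule cont_sv_has_fomin_deriv[OF \<gamma> \<delta>])
  obtain M where M: "\<And>x. norm (g x) \<le> M" and cg: "continuous_on UNIV g"
    using g unfolding bounded_continuous_def by auto
  obtain L where L: "\<And>x. norm (g' x) \<le> L" and cg': "continuous_on UNIV g'"
    using g'(2) unfolding bounded_continuous_def by auto
  define t where "t n = inverse (real (Suc n))" for n
  have t_pos: "t n > 0" for n by (simp add: t_def)
  have t_lim: "t \<longlonglongrightarrow> 0" unfolding t_def by (rule LIMSEQ_inverse_real_of_nat)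
  have t_at: "filterlim t (at 0) sequentially"
    unfolding filterlim_at using t_lim t_pos by (auto simp: less_imp_neq[symmetric])
  define q where "q n = (translate (t n *\<^sub>R v) \<gamma> - \<gamma>) /\<^sub>R t n" for n
  have q_lim: "q \<longlonglongrightarrow> \<delta>"
    using filterlim_compose[OF \<delta>[unfolded has_fomin_deriv_def] t_at] by (simp add: q_def[abs_def])
  have q_cont: "cont_sv (q n)" for n
    unfolding q_def by (intro cont_sv_scaleR cont_sv_diff cont_sv_translate \<gamma>)
  have shift: "bounded_continuous (\<lambda>y. g (y - x))" for x
    unfolding bounded_continuous_def
    using M by (auto intro!: continuous_on_compose2[OF cg] continuous_intros)
  have dq: "dint (q n) g = dint \<gamma> (\<lambda>y. (g (y - t n *\<^sub>R v) - g y) /\<^sub>R t n)" for n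
  proof -
    have "dint (q n) g = (dint (translate (t n *\<^sub>R v) \<gamma>) g - dint \<gamma> g) /\<^sub>R t n"
      unfolding q_def
      by (simp add: dint_scaleR_measure dint_diff_measure cont_sv_diff cont_sv_translate \<gamma> g)
    also have "\<dots> = (dint \<gamma> (\<lambda>y. g (y - t n *\<^sub>R v)) - dint \<gamma> g) /\<^sub>R t n"
      by (simp add: dint_translate \<gamma> g)
    also have "\<dots> = dint \<gamma> (\<lambda>y. (g (y - t n *\<^sub>R v) - g y) /\<^sub>R t n)"
      by (simp add: dint_scaleR dint_diff bounded_continuous_diff shift \<gamma> g)
    finally show ?thesis .
  qed
  have "(\<lambda>n. dint (q n) g) \<longlonglongrightarrow> dint \<delta> g"
  proof (rule LIM_zero_cancel, rule Lim_null_comparison)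
    show "\<forall>\<^sub>F n in sequentially. norm (dint (q n) g - dint \<delta> g) \<le> M * norm (q n - \<delta>)"
    proof (intro always_eventually allI)
      fix n
      have "dint (q n) g - dint \<delta> g = dint (q n - \<delta>) g"
        by (rule dint_diff_measure[OF q_cont cont_\<delta> g, symmetric])
      then show "norm (dint (q n) g - dint \<delta> g) \<le> M * norm (q n - \<delta>)"
        using norm_dint_le[OF cont_sv_diff[OF q_cont cont_\<delta>] cg M] by simp
    qed
    show "(\<lambda>n. M * norm (q n - \<delta>)) \<longlonglongrightarrow> 0"
      using LIM_zero[OF q_lim] by (intro tendsto_mult_right_zero tendsto_norm_zero)
  qed
  moreover have "(\<lambda>n. dint (q n) g) \<longlonglongrightarrow> dint \<gamma> (\<lambda>x. (-1) *\<^sub>R g' x)"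
    unfolding dq
  proof (rule dint_bounded_convergence[OF \<gamma>])
    show "continuous_on UNIV (\<lambda>y. (g (y - t n *\<^sub>R v) - g y) /\<^sub>R t n)" for n
      using shift cg unfolding bounded_continuous_def by (intro continuous_intros) auto
    show "continuous_on UNIV (\<lambda>x. (-1) *\<^sub>R g' x)" using cg' by (intro continuous_intros)
    show "norm ((g (y - t n *\<^sub>R v) - g y) /\<^sub>R t n) \<le> L" for n y
    proof -
      have "norm (g (y - t n *\<^sub>R v + t n *\<^sub>R v) - g (y - t n *\<^sub>R v)) \<le> L * t n"
        using t_pos[of n] by (intro has_dir_deriv_norm_diff_le[OF g'(1) L]) simp
      then have "norm (g (y - t n *\<^sub>R v) - g y) \<le> L * t n" by (simp add: norm_minus_commute)
      then show ?thesis using t_pos[of n] by (simp add: divide_simps)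
    qed
    fix y
    have der: "((\<lambda>s. g (y + s *\<^sub>R v)) has_vector_derivative g' y) (at 0)"
      using g'(1) unfolding has_dir_deriv_def by simp
    have t_at': "filterlim (\<lambda>n. - t n) (at 0) sequentially"
      unfolding filterlim_at using tendsto_minus[OF t_lim] t_pos by (auto simp: less_imp_neq[symmetric])
    have "(\<lambda>n. norm (g (y + (- t n) *\<^sub>R v) - g y - (- t n) *\<^sub>R g' y) / norm (- t n)) \<longlonglongrightarrow> 0"
      using der filterlim_compose[OF _ t_at', of "\<lambda>s. norm (g (y + s *\<^sub>R v) - g y - s *\<^sub>R g' y) / norm s"]
      unfolding has_vector_derivative_def has_derivative_at by simp
    moreover have "norm (g (y + (- t n) *\<^sub>R v) - g y - (- t n) *\<^sub>R g' y) / norm (- t n)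
        = norm ((g (y - t n *\<^sub>R v) - g y) /\<^sub>R t n - (-1) *\<^sub>R g' y)" for n
    proof -
      have "g (y + (- t n) *\<^sub>R v) - g y - (- t n) *\<^sub>R g' y
          = t n *\<^sub>R ((g (y - t n *\<^sub>R v) - g y) /\<^sub>R t n - (-1) *\<^sub>R g' y)"
        using t_pos[of n] by (simp add: scaleR_add_right)
      then show ?thesis using t_pos[of n] by simp
    qed
    ultimately have "(\<lambda>n. norm ((g (y - t n *\<^sub>R v) - g y) /\<^sub>R t n - (-1) *\<^sub>R g' y)) \<longlonglongrightarrow> 0"
      by simp
    then show "(\<lambda>n. (g (y - t n *\<^sub>R v) - g y) /\<^sub>R t n) \<longlonglongrightarrow> (-1) *\<^sub>R g' y"
      by (rule LIM_zero_cancel[OF tendsto_norm_zero_cancel])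
  qed
  ultimately have "dint \<delta> g = dint \<gamma> (\<lambda>x. (-1) *\<^sub>R g' x)" by (rule LIMSEQ_unique)
  also have "\<dots> = - dint \<gamma> g'" using dint_scaleR[OF \<gamma> g'(2), of "-1"] by simp
  finally show ?thesis .
qed

lemma has_dir_deriv_blinfun_apply:
  assumes "has_dir_deriv \<psi> v \<psi>'" "has_dir_deriv F v F'"
  shows "has_dir_deriv (\<lambda>x. blinfun_apply (\<psi> x) (F x)) v
    (\<lambda>x. blinfun_apply (\<psi> x) (F' x) + blinfun_apply (\<psi>' x) (F x))"
  unfolding has_dir_deriv_def
proof
  fix x
  have "((\<lambda>t. blinfun_apply (\<psi> (x + t *\<^sub>R v)) (F (x + t *\<^sub>R v))) has_vector_derivative
      blinfun_apply (\<psi> (x + 0 *\<^sub>R v)) (F' x) + blinfun_apply (\<psi>' x) (F (x + 0 *\<^sub>R v))) (at 0)"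
    using assms unfolding has_dir_deriv_def
    by (intro bounded_bilinear.has_vector_derivative[OF bounded_bilinear_blinfun_apply]) auto
  then show "((\<lambda>t. blinfun_apply (\<psi> (x + t *\<^sub>R v)) (F (x + t *\<^sub>R v))) has_vector_derivative
      blinfun_apply (\<psi> x) (F' x) + blinfun_apply (\<psi>' x) (F x)) (at 0)" by simp
qed

lemma bounded_continuous_blinfun_apply:
  assumes "bounded_continuous \<psi>" "bounded_continuous F"
  shows "bounded_continuous (\<lambda>x. blinfun_apply (\<psi> x) (F x))"
proof -
  obtain M L where *: "\<And>x. norm (\<psi> x) \<le> M" "\<And>x. norm (F x) \<le> L"
    using assms unfolding bounded_continuous_def by auto
  have "norm (blinfun_apply (\<psi> x) (F x)) \<le> M * L" for x
    using norm_blinfun[of "\<psi> x" "F x"] mult_mono[OF * order_trans[OF norm_ge_zero *(1)] norm_ge_zero]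
    by (rule order_trans)
  then show ?thesis
    using assms unfolding bounded_continuous_def
    by (auto intro!: blinfun.continuous_on)
qed

lemma dint_by_parts:
  fixes \<gamma> :: "('a::euclidean_space, 'v::real_normed_vector, 'w::banach) sv_measure"
  assumes \<gamma>: "cont_sv \<gamma>" "has_fomin_deriv \<gamma> v \<delta>"
    and \<psi>: "bounded_continuous \<psi>" "has_dir_deriv \<psi> v \<psi>'" "bounded_continuous \<psi>'"
    and F: "bounded_continuous F" "has_dir_deriv F v F'" "bounded_continuous F'"
  shows "dint \<gamma> (\<lambda>x. blinfun_apply (\<psi> x) (F' x)) =
    - (dint \<delta> (\<lambda>x. blinfun_apply (\<psi> x) (F x)) + dint \<gamma> (\<lambda>x. blinfun_apply (\<psi>' x) (F x)))"
proof -
  note bc = bounded_continuous_blinfun_apply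
  have "dint \<delta> (\<lambda>x. blinfun_apply (\<psi> x) (F x)) =
      - dint \<gamma> (\<lambda>x. blinfun_apply (\<psi> x) (F' x) + blinfun_apply (\<psi>' x) (F x))"
    using \<psi> F
    by (intro dint_fomin_deriv[OF \<gamma>] has_dir_deriv_blinfun_apply bounded_continuous_add bc)
  also have "\<dots> = - (dint \<gamma> (\<lambda>x. blinfun_apply (\<psi> x) (F' x)) + dint \<gamma> (\<lambda>x. blinfun_apply (\<psi>' x) (F x)))"
    using \<psi> F by (simp add: dint_add[OF \<gamma>(1)] bc)
  finally show ?thesis by simp
qed

section \<open>Leibniz sums over multisets\<close>

lemma finite_multiset_splittings: "finite {(\<alpha>, \<beta>). \<alpha> + \<beta> = (h :: 'a multiset)}"
proof (induction h)
  case empty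
  have "{(\<alpha>, \<beta>). \<alpha> + \<beta> = ({#} :: 'a multiset)} = {({#}, {#})}" by auto
  then show ?case by simp
next
  case (add v h)
  let ?P = "{(\<alpha>, \<beta>). \<alpha> + \<beta> = h}"
  have "{(\<alpha>, \<beta>). \<alpha> + \<beta> = add_mset v h}
      \<subseteq> (\<lambda>(\<alpha>, \<beta>). (add_mset v \<alpha>, \<beta>)) ` ?P \<union> (\<lambda>(\<alpha>, \<beta>). (\<alpha>, add_mset v \<beta>)) ` ?P"
  proof safe
    fix \<alpha> \<beta> :: "'a multiset"
    assume eq: "\<alpha> + \<beta> = add_mset v h"
      and no: "(\<alpha>, \<beta>) \<notin> (\<lambda>(\<alpha>, \<beta>). (\<alpha>, add_mset v \<beta>)) ` {(\<alpha>, \<beta>). \<alpha> + \<beta> = h}"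
    have "v \<in># \<alpha> + \<beta>" by (simp add: eq)
    then consider "v \<in># \<alpha>" | "v \<in># \<beta>" by auto
    then show "(\<alpha>, \<beta>) \<in> (\<lambda>(\<alpha>, \<beta>). (add_mset v \<alpha>, \<beta>)) ` {(\<alpha>, \<beta>). \<alpha> + \<beta> = h}"
    proof cases
      case 1
      then obtain \<alpha>' where "\<alpha> = add_mset v \<alpha>'" by (auto dest: multi_member_split)
      with eq show ?thesis by (intro image_eqI[of _ _ "(\<alpha>', \<beta>)"]) auto
    next
      case 2
      then obtain \<beta>' where "\<beta> = add_mset v \<beta>'" by (auto dest: multi_member_split)
      with eq no show ?thesis by (auto simp: image_iff)
    qed
  qed
  then show ?case using add by (auto intro: finite_subset)
qed

lemma multi_coeff_eq_prod:
  assumes "finite X" "set_mset (\<alpha> + \<beta>) \<subseteq> X"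
  shows "multi_coeff \<alpha> \<beta> =
    (\<Prod>x\<in>X. fact (count \<alpha> x + count \<beta> x) / (fact (count \<alpha> x) * fact (count \<beta> x)))"
  unfolding multi_coeff_def
  by (rule prod.mono_neutral_left[OF assms]) (auto simp: not_in_iff)

lemma multi_coeff_empty [simp]: "multi_coeff {#} {#} = 1"
  by (simp add: multi_coeff_def)

lemma factorial_pascal:
  assumes "m + n > 0"
  shows "(fact (m + n) / (fact m * fact n) :: real) =
    (if m > 0 then fact (m - 1 + n) / (fact (m - 1) * fact n) else 0) +
    (if n > 0 then fact (m + (n - 1)) / (fact m * fact (n - 1)) else 0)"
proof -
  have *: "fact (m + n) / (fact m * fact n) = real ((m + n) choose m)" for m n
    by (simp add: binomial_fact)
  show ?thesis
    unfolding * using assms by (cases m; cases n) auto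
qed

text \<open>Pascal's rule for the coefficients \<open>C(\<alpha>, \<beta>)\<close>, one vector being removed.\<close>

lemma multi_coeff_pascal:
  assumes "v \<in># \<alpha> + \<beta>"
  shows "multi_coeff \<alpha> \<beta> =
    (if v \<in># \<alpha> then multi_coeff (\<alpha> - {#v#}) \<beta> else 0) +
    (if v \<in># \<beta> then multi_coeff \<alpha> (\<beta> - {#v#}) else 0)"
proof -
  define X where "X = set_mset (\<alpha> + \<beta>)"
  define b :: "nat \<Rightarrow> nat \<Rightarrow> real" where "b m n = fact (m + n) / (fact m * fact n)" for m n
  define R where "R = (\<Prod>x\<in>X - {v}. b (count \<alpha> x) (count \<beta> x))"
  have X: "finite X" "v \<in> X" using assms by (auto simp: X_def)
  have *: "multi_coeff \<alpha>' \<beta>' = b (count \<alpha>' v) (count \<beta>' v) * R"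
    if "set_mset (\<alpha>' + \<beta>') \<subseteq> X" "\<And>x. x \<noteq> v \<Longrightarrow> count \<alpha>' x = count \<alpha> x"
      "\<And>x. x \<noteq> v \<Longrightarrow> count \<beta>' x = count \<beta> x" for \<alpha>' \<beta>'
  proof -
    have "multi_coeff \<alpha>' \<beta>' = (\<Prod>x\<in>X. b (count \<alpha>' x) (count \<beta>' x))"
      unfolding b_def by (rule multi_coeff_eq_prod[OF X(1) that(1)])
    also have "\<dots> = b (count \<alpha>' v) (count \<beta>' v) * (\<Prod>x\<in>X - {v}. b (count \<alpha>' x) (count \<beta>' x))"
      by (rule prod.remove[OF X])
    finally show ?thesis using that(2,3) by (simp add: R_def)
  qed
  have 1: "multi_coeff \<alpha> \<beta> = b (count \<alpha> v) (count \<beta> v) * R"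
    by (rule *) (auto simp: X_def)
  have 2: "multi_coeff (\<alpha> - {#v#}) \<beta> = b (count \<alpha> v - 1) (count \<beta> v) * R"
    by (subst *) (auto simp: X_def dest: in_diffD)
  have 3: "multi_coeff \<alpha> (\<beta> - {#v#}) = b (count \<alpha> v) (count \<beta> v - 1) * R"
    by (subst *) (auto simp: X_def dest: in_diffD)
  have "count \<alpha> v + count \<beta> v > 0" using assms by (auto simp: count_greater_zero_iff)
  from factorial_pascal[OF this] show ?thesis
    unfolding 1 2 3 by (simp add: b_def distrib_right flip: count_greater_zero_iff)
qed

text \<open>
  Summed over all splittings, Pascal's rule says that the new vector \<open>v\<close> joins either \<open>\<alpha>\<close> or \<open>\<beta>\<close>.
\<close>

lemma leibniz_sum_add_mset:
  fixes T :: "'a multiset \<Rightarrow> 'a multiset \<Rightarrow> 'e::real_vector"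
  shows "(\<Sum>(\<alpha>, \<beta>) | \<alpha> + \<beta> = add_mset v h. multi_coeff \<alpha> \<beta> *\<^sub>R T \<alpha> \<beta>) =
    (\<Sum>(\<alpha>, \<beta>) | \<alpha> + \<beta> = h. multi_coeff \<alpha> \<beta> *\<^sub>R (T (add_mset v \<alpha>) \<beta> + T \<alpha> (add_mset v \<beta>)))"
proof -
  let ?P = "{(\<alpha>, \<beta>). \<alpha> + \<beta> = h}" and ?Q = "{(\<alpha>, \<beta>). \<alpha> + \<beta> = add_mset v h}"
  let ?A = "\<lambda>(\<alpha>, \<beta>). if v \<in># \<alpha> then multi_coeff (\<alpha> - {#v#}) \<beta> *\<^sub>R T \<alpha> \<beta> else 0"
  let ?B = "\<lambda>(\<alpha>, \<beta>). if v \<in># \<beta> then multi_coeff \<alpha> (\<beta> - {#v#}) *\<^sub>R T \<alpha> \<beta> else 0"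
  have "(\<Sum>(\<alpha>, \<beta>)\<in>?Q. multi_coeff \<alpha> \<beta> *\<^sub>R T \<alpha> \<beta>) = (\<Sum>p\<in>?Q. ?A p + ?B p)"
  proof (intro sum.cong refl)
    fix p assume "p \<in> ?Q"
    then obtain \<alpha> \<beta> where p: "p = (\<alpha>, \<beta>)" "\<alpha> + \<beta> = add_mset v h" by auto
    then have "v \<in># \<alpha> + \<beta>" by simp
    from multi_coeff_pascal[OF this]
    show "(case p of (\<alpha>, \<beta>) \<Rightarrow> multi_coeff \<alpha> \<beta> *\<^sub>R T \<alpha> \<beta>) = ?A p + ?B p"
      by (simp add: p(1) scaleR_add_left)
  qed
  also have "\<dots> = (\<Sum>p\<in>?Q. ?A p) + (\<Sum>p\<in>?Q. ?B p)" by (rule sum.distrib)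
  also have "(\<Sum>p\<in>?Q. ?A p) = (\<Sum>(\<alpha>, \<beta>)\<in>?P. multi_coeff \<alpha> \<beta> *\<^sub>R T (add_mset v \<alpha>) \<beta>)"
  proof -
    have "(\<Sum>p\<in>?Q. ?A p) = (\<Sum>p\<in>(\<lambda>(\<alpha>, \<beta>). (add_mset v \<alpha>, \<beta>)) ` ?P. ?A p)"
    proof (rule sum.mono_neutral_right[OF finite_multiset_splittings])
      show "\<forall>p\<in>?Q - (\<lambda>(\<alpha>, \<beta>). (add_mset v \<alpha>, \<beta>)) ` ?P. ?A p = 0"
      proof safe
        fix \<alpha> \<beta> assume eq: "\<alpha> + \<beta> = add_mset v h"
          and no: "(\<alpha>, \<beta>) \<notin> (\<lambda>(\<alpha>, \<beta>). (add_mset v \<alpha>, \<beta>)) ` ?P"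
        have "v \<notin># \<alpha>"
        proof
          assume "v \<in># \<alpha>"
          then obtain \<alpha>' where "\<alpha> = add_mset v \<alpha>'" by (auto dest: multi_member_split)
          with eq no show False by (auto simp: image_iff)
        qed
        then show "(if v \<in># \<alpha> then multi_coeff (\<alpha> - {#v#}) \<beta> *\<^sub>R T \<alpha> \<beta> else 0) = 0" by simp
      qed
    qed auto
    also have "\<dots> = (\<Sum>(\<alpha>, \<beta>)\<in>?P. multi_coeff \<alpha> \<beta> *\<^sub>R T (add_mset v \<alpha>) \<beta>)"
      by (subst sum.reindex) (auto simp: inj_on_def intro!: sum.cong)
    finally show ?thesis .
  qed
  also have "(\<Sum>p\<in>?Q. ?B p) = (\<Sum>(\<alpha>, \<beta>)\<in>?P. multi_coeff \<alpha> \<beta> *\<^sub>R T \<alpha> (add_mset v \<beta>))"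
  proof -
    have "(\<Sum>p\<in>?Q. ?B p) = (\<Sum>p\<in>(\<lambda>(\<alpha>, \<beta>). (\<alpha>, add_mset v \<beta>)) ` ?P. ?B p)"
    proof (rule sum.mono_neutral_right[OF finite_multiset_splittings])
      show "\<forall>p\<in>?Q - (\<lambda>(\<alpha>, \<beta>). (\<alpha>, add_mset v \<beta>)) ` ?P. ?B p = 0"
      proof safe
        fix \<alpha> \<beta> assume eq: "\<alpha> + \<beta> = add_mset v h"
          and no: "(\<alpha>, \<beta>) \<notin> (\<lambda>(\<alpha>, \<beta>). (\<alpha>, add_mset v \<beta>)) ` ?P"
        have "v \<notin># \<beta>"
        proof
          assume "v \<in># \<beta>"
          then obtain \<beta>' where "\<beta> = add_mset v \<beta>'" by (auto dest: multi_member_split)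
          with eq no show False by (auto simp: image_iff)
        qed
        then show "(if v \<in># \<beta> then multi_coeff \<alpha> (\<beta> - {#v#}) *\<^sub>R T \<alpha> \<beta> else 0) = 0" by simp
      qed
    qed auto
    also have "\<dots> = (\<Sum>(\<alpha>, \<beta>)\<in>?P. multi_coeff \<alpha> \<beta> *\<^sub>R T \<alpha> (add_mset v \<beta>))"
      by (subst sum.reindex) (auto simp: inj_on_def intro!: sum.cong)
    finally show ?thesis .
  qed
  also have "(\<Sum>(\<alpha>, \<beta>)\<in>?P. multi_coeff \<alpha> \<beta> *\<^sub>R T (add_mset v \<alpha>) \<beta>)
      + (\<Sum>(\<alpha>, \<beta>)\<in>?P. multi_coeff \<alpha> \<beta> *\<^sub>R T \<alpha> (add_mset v \<beta>))
      = (\<Sum>(\<alpha>, \<beta>)\<in>?P. multi_coeff \<alpha> \<beta> *\<^sub>R (T (add_mset v \<alpha>) \<beta> + T \<alpha> (add_mset v \<beta>)))"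
    by (subst sum.distrib[symmetric]) (auto simp: scaleR_add_right intro!: sum.cong)
  finally show ?thesis .
qed

section \<open>Integration by parts of higher order\<close>

text \<open>
  The derivatives \<open>\<alpha>0\<close> and \<open>\<beta>0\<close> that have already been moved to \<open>\<mu>\<close> and \<open>\<phi>\<close> are carried along to make
  the induction work.
\<close>

lemma dint_by_parts_iterated:
  fixes \<mu> :: "('a::euclidean_space, 'v::real_normed_vector, 'w::banach) sv_measure"
    and f :: "'a \<Rightarrow> 'v" and \<phi> :: "'a \<Rightarrow> 'v \<Rightarrow>\<^sub>L 'v"
  assumes \<mu>: "iter_smooth k (\<lambda>x. translate x \<mu>)" "cont_sv \<mu>"
    and f: "C_B_k k f" and \<phi>: "C_B_k k \<phi>"
  defines "J \<equiv> \<lambda>\<alpha> \<beta> \<eta>. dint (mixed fomin_deriv \<alpha> \<mu>)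
      (\<lambda>x. blinfun_apply (mixed dir_deriv \<beta> \<phi> x) (mixed dir_deriv \<eta> f x))"
  shows "size h + size \<alpha>0 \<le> k \<Longrightarrow> size h + size \<beta>0 \<le> k \<Longrightarrow>
    J \<alpha>0 \<beta>0 h = (- 1) ^ size h *\<^sub>R
      (\<Sum>(\<alpha>, \<beta>) | \<alpha> + \<beta> = h. multi_coeff \<alpha> \<beta> *\<^sub>R J (\<alpha>0 + \<alpha>) (\<beta>0 + \<beta>) {#})"
proof (induction h arbitrary: \<alpha>0 \<beta>0)
  case empty
  have "{(\<alpha>, \<beta>). \<alpha> + \<beta> = ({#} :: 'a multiset)} = {({#}, {#})}" by auto
  then show ?case by simp
next
  case (add v h)
  let ?P = "{(\<alpha>, \<beta>). \<alpha> + \<beta> = h}"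
  have size: "size \<alpha>0 < k" "size \<beta>0 < k" "size h < k" using add.prems by auto
  have "J \<alpha>0 \<beta>0 (add_mset v h) = - (J (add_mset v \<alpha>0) \<beta>0 h + J \<alpha>0 (add_mset v \<beta>0) h)"
    unfolding J_def using size
    by (intro dint_by_parts[where v = v] cont_sv_mixed_fomin_deriv[OF \<mu>] mixed_fomin_deriv_add[OF \<mu>(1)]
        bounded_continuous_mixed[OF f] bounded_continuous_mixed[OF \<phi>]
        mixed_dir_deriv_add[OF iter_smooth_C_B_k[OF f]] mixed_dir_deriv_add[OF iter_smooth_C_B_k[OF \<phi>]]) auto
  also have "\<dots> = - ((- 1) ^ size h *\<^sub>R
      ((\<Sum>(\<alpha>, \<beta>)\<in>?P. multi_coeff \<alpha> \<beta> *\<^sub>R J (add_mset v \<alpha>0 + \<alpha>) (\<beta>0 + \<beta>) {#})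
      + (\<Sum>(\<alpha>, \<beta>)\<in>?P. multi_coeff \<alpha> \<beta> *\<^sub>R J (\<alpha>0 + \<alpha>) (add_mset v \<beta>0 + \<beta>) {#})))"
    using add.prems by (simp add: add.IH scaleR_add_right)
  also have "(\<Sum>(\<alpha>, \<beta>)\<in>?P. multi_coeff \<alpha> \<beta> *\<^sub>R J (add_mset v \<alpha>0 + \<alpha>) (\<beta>0 + \<beta>) {#})
      + (\<Sum>(\<alpha>, \<beta>)\<in>?P. multi_coeff \<alpha> \<beta> *\<^sub>R J (\<alpha>0 + \<alpha>) (add_mset v \<beta>0 + \<beta>) {#})
      = (\<Sum>(\<alpha>, \<beta>)\<in>?P. multi_coeff \<alpha> \<beta> *\<^sub>R
          (J (\<alpha>0 + add_mset v \<alpha>) (\<beta>0 + \<beta>) {#} + J (\<alpha>0 + \<alpha>) (\<beta>0 + add_mset v \<beta>) {#}))"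
    by (subst sum.distrib[symmetric]) (auto simp: scaleR_add_right intro!: sum.cong)
  also have "\<dots> = (\<Sum>(\<alpha>, \<beta>) | \<alpha> + \<beta> = add_mset v h.
      multi_coeff \<alpha> \<beta> *\<^sub>R J (\<alpha>0 + \<alpha>) (\<beta>0 + \<beta>) {#})"
    by (rule leibniz_sum_add_mset[symmetric])
  finally show ?case by simp
qed

theorem corollary3p4p4:
  fixes F :: "complex set"
    and sV :: "complex \<Rightarrow> 'v \<Rightarrow> 'v::banach"
    and sW :: "complex \<Rightarrow> 'w \<Rightarrow> 'w::banach"
    and k :: nat
    and \<mu> :: "(real ^ 'd, 'v, 'w) sv_measure"
    and f :: "real ^ 'd \<Rightarrow> 'v"
    and \<phi> :: "real ^ 'd \<Rightarrow> 'v \<Rightarrow>\<^sub>L 'v"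
    and h :: "(real ^ 'd) multiset"
  assumes "F = \<real> \<or> F = UNIV"
    and "normed_scaling F sV" and "normed_scaling F sW"
    and "range (measure_of_sv \<mu>) \<subseteq> linear_ops F sV sW"
    and "C_k_sv k \<mu>" and "continuous_semivariation (measure_of_sv \<mu>)"
    and "C_B_k k f"
    and "range \<phi> \<subseteq> linear_ops F sV sV" and "C_B_k k \<phi>"
    and "size h \<le> k"
  shows "dobrakov_integral \<mu> UNIV (\<lambda>x. blinfun_apply (\<phi> x) (mixed dir_deriv h f x)) =
    (- 1) ^ size h *\<^sub>R
      (\<Sum>(\<alpha>, \<beta>) | \<alpha> + \<beta> = h. multi_coeff \<alpha> \<beta> *\<^sub>R
         dobrakov_integral (mixed fomin_deriv \<alpha> \<mu>) UNIV
           (\<lambda>x. blinfun_apply (mixed dir_deriv \<beta> \<phi> x) (f x)))"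
proof -
  have "iter_smooth k (\<lambda>x. translate x \<mu>)"
    using assms(5) iter_smooth_if_frechet unfolding C_k_sv_def C_k_def by blast
  from dint_by_parts_iterated[OF this assms(6,7,9), of h "{#}" "{#}"] assms(10)
  show ?thesis by simp
qed

end
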